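(* Let $m\ge2$ be an integer and let $a\in(0,\frac1{2m}]$. Then $(f_a,\mathrm{Leb})$ is exact (on $[0,1]^2$ with its Borel sigma-algebra), and $(g_a|_{\Lambda_{a,\frac1m-a}},\mathrm{Leb}|_{\Lambda_{a,\frac1m-a}})$ has $K$-property (on $\Lambda_{a,\frac1m-a}$ with its Borel sigma-algebra).
   Context: Heterochaos baker maps. Let $m\ge2$ be an integer and $D=\{\alpha_1,\dots,\alpha_m\}\cup\{\beta_1,\dots,\beta_m\}$. For $a\in(0,\frac1m)$ define $\tau_a\colon[0,1]\to[0,1]$ by $\tau_a(x)=\frac{x-(i-1)a}{a}$ on $[(i-1)a,ia)$ for $i\in\{1,\dots,m\}$, and $\tau_a(x)=\frac{x-ma}{1-ma}$ on $[ma,1]$. Put $\Omega_{\alpha_i}^+=[(i-1)a,ia)\times[0,1]$ for $i\in\{1,\dots,m\}$; $\Omega_{\beta_i}^+=[ma,1]\times[\frac{i-1}{m},\frac im)$ for $i\in\{1,\dots,m-1\}$ and $\Omega_{\beta_m}^+=[ma,1]\times[\frac{m-1}{m},1]$. Define $f_a\colon[0,1]^2\to[0,1]^2$ by $f_a(x,y)=(\tau_a(x),\frac ym+\frac{i-1}{m})$ on $\Omega_{\alpha_i}^+$ and $f_a(x,y)=(\tau_a(x),my-i+1)$ on $\Omega_{\beta_i}^+$. Put $\Omega_{\gamma}=\Omega_{\gamma}^+\times[0,1]$ for $\gamma\in D$. For $a,b\in(0,\frac1m)$ define $f_{a,b}\colon[0,1]^3\to[0,1]^3$ by $f_{a,b}(x,y,z)=(f_a(x,y),(1-mb)z)$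 on $\Omega_{\alpha_i}$ and $f_{a,b}(x,y,z)=(f_a(x,y),bz+1+b(i-m-1))$ on $\Omega_{\beta_i}$. Put $g_a=f_{a,\frac1m-a}$, and $\Lambda_{a,b}=\bigcap_{n=-\infty}^{\infty}f_{a,b}^{-n}\left(\bigcup_{\gamma\in D}\mathrm{int}(\Omega_\gamma)\right)$, where $\mathrm{int}$ is the interior in $\mathbb R^3$ (for $n<0$, $f_{a,b}^{-n}$ denotes forward image under $f_{a,b}^{|n|}$). $\mathrm{Leb}$ is Lebesgue measure on $[0,1]^2$ or $[0,1]^3$; it is preserved by $f_a$ and $g_a$, and $\mathrm{Leb}(\Lambda_{a,\frac1m-a})=1$. Exactness and $K$-property. Let $(X,\mathscr B,\nu)$ be a probability space. For sub-sigma-algebras $\mathscr C,\mathscr D$ of $\mathscr B$ write $\mathscr C\stackrel{\circ}{\subset}\mathscr D$ if for every $C\in\mathscr C$ there is $E\in\mathscr D$ with $\nu(C\ominus E)=0$ ($\ominus$ is symmetric difference), and $\mathscr C\stackrel{\circ}{=}\mathscr D$ if both $\mathscr C\stackrel{\circ}{\subset}\mathscr D$ and $\mathscr D\stackrel{\circ}{\subset}\mathscr C$. $\bigvee_n\mathscr B_n$ denotes the smallest sub-sigma-algebra containing all $\mathscr B_n$. Let $T\colon X\to X$ be measurable and preserve $\nu$; $T^{-n}\mathscr C=\{T^{-n}(B):B\in\mathscr C\}$ and, if $T$ has a measurable inverse, $T^n\mathscr C=\{T^n(B):B\in\mathscr C\}$. $(T,\nu)$ is exact if $T$ has no measurable inverse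 and $\bigcap_{n=0}^\infty T^{-n}\mathscr B\stackrel{\circ}{=}\{X,\emptyset\}$. $(T,\nu)$ has $K$-property if $T$ has a measurable inverse and there is a sub-sigma-algebra $\mathscr K$ of $\mathscr B$ such that (i) $\mathscr K\subset T\mathscr K$; (ii) $\bigvee_{n=0}^\infty T^n\mathscr K\stackrel{\circ}{=}\mathscr B$; (iii) $\bigcap_{n=0}^\infty T^{-n}\mathscr K\stackrel{\circ}{=}\{X,\emptyset\}$. *)

theory Defs
  imports "HOL-Probability.Probability"
begin

section \<open>Exactness and the K-property\<close>

definition measure_preserving_system :: "'a measure \<Rightarrow> ('a \<Rightarrow> 'a) \<Rightarrow> bool" where
  "measure_preserving_system M T \<longleftrightarrow> prob_space M \<and> T \<in> measurable M M \<and> distr M M T = M"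

text \<open>The inverse is a genuine, everywhere defined inverse on the space, not one modulo null sets.\<close>

definition has_measurable_inverse :: "'a measure \<Rightarrow> ('a \<Rightarrow> 'a) \<Rightarrow> bool" where
  "has_measurable_inverse M T \<longleftrightarrow>
     (\<exists>S\<in>measurable M M. \<forall>x\<in>space M. S (T x) = x \<and> T (S x) = x)"

definition sub_sigma_algebra :: "'a measure \<Rightarrow> 'a set set \<Rightarrow> bool" where
  "sub_sigma_algebra M \<C> \<longleftrightarrow> sigma_algebra (space M) \<C> \<and> \<C> \<subseteq> sets M"

definition subset_mod_null :: "'a measure \<Rightarrow> 'a set set \<Rightarrow> 'a set set \<Rightarrow> bool" where
  "subset_mod_null M \<C> \<D> \<longleftrightarrow> (\<forall>C\<in>\<C>. \<exists>E\<in>\<D>. emeasure M (sym_diff C E) = 0)"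

definition eq_mod_null :: "'a measure \<Rightarrow> 'a set set \<Rightarrow> 'a set set \<Rightarrow> bool" where
  "eq_mod_null M \<C> \<D> \<longleftrightarrow> subset_mod_null M \<C> \<D> \<and> subset_mod_null M \<D> \<C>"

definition pullback_family :: "'a measure \<Rightarrow> ('a \<Rightarrow> 'a) \<Rightarrow> nat \<Rightarrow> 'a set set \<Rightarrow> 'a set set" where
  "pullback_family M T n \<C> = {(T ^^ n) -` B \<inter> space M | B. B \<in> \<C>}"

definition pushforward_family :: "('a \<Rightarrow> 'a) \<Rightarrow> nat \<Rightarrow> 'a set set \<Rightarrow> 'a set set" where
  "pushforward_family T n \<C> = {(T ^^ n) ` B | B. B \<in> \<C>}"

definition exact :: "'a measure \<Rightarrow> ('a \<Rightarrow> 'a) \<Rightarrow> bool" where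
  "exact M T \<longleftrightarrow>
     measure_preserving_system M T \<and>
     \<not> has_measurable_inverse M T \<and>
     eq_mod_null M (\<Inter>n. pullback_family M T n (sets M)) {space M, {}}"

definition K_property :: "'a measure \<Rightarrow> ('a \<Rightarrow> 'a) \<Rightarrow> bool" where
  "K_property M T \<longleftrightarrow>
     measure_preserving_system M T \<and>
     has_measurable_inverse M T \<and>
     (\<exists>\<K>. sub_sigma_algebra M \<K> \<and>
        \<K> \<subseteq> pushforward_family T 1 \<K> \<and>
        eq_mod_null M (sigma_sets (space M) (\<Union>n. pushforward_family T n \<K>)) (sets M) \<and>
        eq_mod_null M (\<Inter>n. pullback_family M T n \<K>) {space M, {}})"


section \<open>Heterochaos baker maps\<close>

datatype symb = Alpha nat | Beta nat

definition alphabet :: "nat \<Rightarrow> symb set" where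
  "alphabet m = Alpha ` {1..m} \<union> Beta ` {1..m}"

text \<open>The maps below are total functions; only their values on the unit interval, square and
  cube are meaningful.\<close>

definition tau :: "nat \<Rightarrow> real \<Rightarrow> real \<Rightarrow> real" where
  "tau m a x =
     (if x < m * a
      then let i = (THE i. i \<in> {1..m} \<and> x \<in> {(real i - 1) * a ..< real i * a})
           in (x - (real i - 1) * a) / a
      else (x - m * a) / (1 - m * a))"

fun Omega_plus :: "nat \<Rightarrow> real \<Rightarrow> symb \<Rightarrow> (real \<times> real) set" where
  "Omega_plus m a (Alpha i) = {(real i - 1) * a ..< real i * a} \<times> {0..1}"
| "Omega_plus m a (Beta i) =
     {m * a .. 1} \<times>
     (if i = m then {(real m - 1) / m .. 1} else {(real i - 1) / m ..< real i / m})"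

definition Omega :: "nat \<Rightarrow> real \<Rightarrow> symb \<Rightarrow> ((real \<times> real) \<times> real) set" where
  "Omega m a \<gamma> = Omega_plus m a \<gamma> \<times> {0..1}"

text \<open>The sets \<open>Omega_plus m a \<gamma>\<close> partition the unit square, so the symbol is well defined there.\<close>

definition symbol_of :: "nat \<Rightarrow> real \<Rightarrow> real \<times> real \<Rightarrow> symb" where
  "symbol_of m a p = (THE \<gamma>. \<gamma> \<in> alphabet m \<and> p \<in> Omega_plus m a \<gamma>)"

definition baker2 :: "nat \<Rightarrow> real \<Rightarrow> real \<times> real \<Rightarrow> real \<times> real" where
  "baker2 m a = (\<lambda>(x, y).
     (case symbol_of m a (x, y) of
        Alpha i \<Rightarrow> (tau m a x, y / m + (real i - 1) / m)
      | Beta i \<Rightarrow> (tau m a x, m * y - real i + 1)))"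

definition baker3 ::
  "nat \<Rightarrow> real \<Rightarrow> real \<Rightarrow> (real \<times> real) \<times> real \<Rightarrow> (real \<times> real) \<times> real" where
  "baker3 m a b = (\<lambda>(p, z).
     (case symbol_of m a p of
        Alpha i \<Rightarrow> (baker2 m a p, (1 - m * b) * z)
      | Beta i \<Rightarrow> (baker2 m a p, b * z + 1 + b * (real i - real m - 1))))"

definition baker_g :: "nat \<Rightarrow> real \<Rightarrow> (real \<times> real) \<times> real \<Rightarrow> (real \<times> real) \<times> real" where
  "baker_g m a = baker3 m a (1 / m - a)"

definition unit_square :: "(real \<times> real) set" where
  "unit_square = {0..1} \<times> {0..1}"

definition unit_cube :: "((real \<times> real) \<times> real) set" where
  "unit_cube = unit_square \<times> {0..1}"

text \<open>\<open>T\<^sup>-\<^sup>n(A)\<close> for integer \<open>n\<close> and a self-map \<open>T\<close> of \<open>X\<close>, not necessarily invertible: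
  preimage in \<open>X\<close> for \<open>n \<ge> 0\<close>, forward image under the \<open>\<bar>n\<bar>\<close>-th iterate for \<open>n < 0\<close>.\<close>

definition int_preimage :: "'a set \<Rightarrow> ('a \<Rightarrow> 'a) \<Rightarrow> int \<Rightarrow> 'a set \<Rightarrow> 'a set" where
  "int_preimage X T n A =
     (if n \<ge> 0 then (T ^^ nat n) -` A \<inter> X else (T ^^ nat \<bar>n\<bar>) ` A)"

definition Lambda :: "nat \<Rightarrow> real \<Rightarrow> real \<Rightarrow> ((real \<times> real) \<times> real) set" where
  "Lambda m a b =
     (\<Inter>n::int. int_preimage unit_cube (baker3 m a b) n
        (\<Union>\<gamma>\<in>alphabet m. interior (Omega m a \<gamma>)))"

text \<open>Lebesgue measure on the Borel sets of a subset \<open>S\<close>. The total maps above act on it through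
  their restriction to \<open>S\<close>.\<close>

definition Leb_on :: "'a::euclidean_space set \<Rightarrow> 'a measure" where
  "Leb_on S = restrict_space lborel S"

end

theory Submission
  imports Defs
begin

text \<open>
  Read \<open>y\<close> as a stack of base-\<open>m\<close> digits: \<open>f\<^sub>a\<close> pushes a digit with probability \<open>m * a \<le> 1/2\<close>
  and otherwise pops one, while \<open>x\<close> supplies the independent choices. If \<open>A\<close> is a tail set, the relative
  deviation of \<open>A\<close> from independence on horizontal \<open>m\<close>-adic strips is bounded by a function of the level that is
  bounded, zero at level \<open>0\<close> and subharmonic for this walk, hence zero. Splitting along the \<open>x\<close>-strips
  extends this to rectangles \<open>[0,t) \<times> J\<close> by a contraction argument, so \<open>A\<close> is independent of
  every Borel set, in particular of itself.

  The map \<open>g\<^sub>a\<close> is a skew product over \<open>f\<^sub>a\<close> that contracts the fibres and has an almost everywhere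
  defined inverse. The Borel sets of the square, pulled back to the cube, thus form a sigma-algebra as in the
  K-property, whose tail is that of \<open>f\<^sub>a\<close>.
\<close>

section \<open>Affine maps and measure preliminaries\<close>

text \<open>The obstacle is that \<open>f\<close> does not expand in \<open>y\<close>: an
  \<alpha>-branch contracts \<open>y\<close> by the factor \<open>m\<close>, so a strip of level
  \<open>k\<close> is carried to finer strips as well as to coarser ones, and independence cannot be
  read off after a fixed number of steps. What saves the argument is that the walk on levels has
  drift \<open>2 * m * a - 1\<close>, which is nonpositive exactly when
  \<open>a \<le> 1 / (2 * m)\<close>. For an upward probability \<open>p\<close> with 1/2 < p < 1
  the function \<open>1 - ((1 - p) / p) ^ k\<close> is bounded, zero at level 0, positive above it
  and harmonic, so subharmonicity alone would prove nothing. Multiplying by \<open>m ^ k\<close>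
  makes deviations on different levels comparable: one step then averages them with weight
  \<open>a\<close> for each \<alpha>-strip and \<open>1 - m * a\<close> for the \<beta>-strip. In
  the cube, the parameter \<open>1 / m - a\<close> is what gives every branch of \<open>g\<close>
  Jacobian 1, and the invariance for \<open>f\<close> is inherited from \<open>g\<close>. Boundary
  points of the half-open boxes spoil injectivity, which is why open boxes are played off against
  closed ones.\<close>

text \<open>For an affine map the factor \<open>k\<close> is the reciprocal of its Jacobian.\<close>

definition scales :: "('a::euclidean_space \<Rightarrow> 'a) \<Rightarrow> real \<Rightarrow> bool" where
  "scales \<phi> k \<longleftrightarrow> k \<ge> 0 \<and> \<phi> \<in> borel_measurable borel \<and>
     (\<forall>A\<in>sets borel. emeasure lborel (\<phi> -` A) = ennreal k * emeasure lborel A)"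

lemma scales_affine:
  fixes c t :: real
  assumes "c \<noteq> 0"
  shows "scales (\<lambda>x. t + c * x) (1 / \<bar>c\<bar>)"
  unfolding scales_def
proof (intro conjI ballI)
  fix A :: "real set"
  assume A: "A \<in> sets borel"
  have "emeasure lborel A = ennreal \<bar>c\<bar> * emeasure lborel ((\<lambda>x. t + c * x) -` A)"
    using A by (subst lborel_real_affine[OF assms, of t])
      (simp add: emeasure_density nn_integral_distr nn_integral_cmult_indicator emeasure_distr
        nn_integral_cmult)
  then have "ennreal (1 / \<bar>c\<bar>) * emeasure lborel A
      = ennreal (1 / \<bar>c\<bar>) * ennreal \<bar>c\<bar> * emeasure lborel ((\<lambda>x. t + c * x) -` A)"
    by (simp add: mult.assoc)
  also have "ennreal (1 / \<bar>c\<bar>) * ennreal \<bar>c\<bar> = 1"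
    using assms by (simp add: ennreal_mult[symmetric])
  finally show "emeasure lborel ((\<lambda>x. t + c * x) -` A) = ennreal (1 / \<bar>c\<bar>) * emeasure lborel A"
    by simp
qed auto

lemma map_prod_borel:
  fixes \<phi> :: "'a::euclidean_space \<Rightarrow> 'a" and \<psi> :: "'b::euclidean_space \<Rightarrow> 'b"
  assumes [measurable]: "\<phi> \<in> borel_measurable borel" "\<psi> \<in> borel_measurable borel"
  shows "map_prod \<phi> \<psi> \<in> borel_measurable borel"
  unfolding map_prod_def case_prod_beta borel_prod[symmetric] by measurable

text \<open>By Fubini: the section of the preimage over \<open>x\<close> is the
  \<open>\<psi>\<close>-preimage of the section over \<open>\<phi> x\<close>, so
  \<open>\<psi>\<close> contributes \<open>l\<close> inside the integral and the substitution by
  \<open>\<phi>\<close> contributes \<open>k\<close> outside. Jacobians of the branches can thus be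
  found one coordinate at a time.\<close>

lemma scales_map_prod:
  assumes "scales \<phi> k" "scales \<psi> l"
  shows "scales (map_prod \<phi> \<psi>) (k * l)"
proof -
  have [measurable]: "\<phi> \<in> borel_measurable borel" "\<psi> \<in> borel_measurable borel"
    and kl: "k \<ge> 0" "l \<ge> 0"
    and \<phi>: "\<And>A. A \<in> sets borel \<Longrightarrow> emeasure lborel (\<phi> -` A) = ennreal k * emeasure lborel A"
    and \<psi>: "\<And>A. A \<in> sets borel \<Longrightarrow> emeasure lborel (\<psi> -` A) = ennreal l * emeasure lborel A"
    using assms by (auto simp: scales_def)
  have d: "distr lborel borel \<phi> = scale_measure (ennreal k) lborel"
    by (rule measure_eqI) (auto simp: emeasure_distr \<phi>)
  have m: "map_prod \<phi> \<psi> \<in> borel_measurable borel"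
    by (rule map_prod_borel) measurable
  show ?thesis
    unfolding scales_def
  proof (intro conjI ballI m)
    fix A :: "('a \<times> 'b) set"
    assume A: "A \<in> sets borel"
    then have A': "A \<in> sets (borel \<Otimes>\<^sub>M borel)" "A \<in> sets (lborel \<Otimes>\<^sub>M lborel)"
      unfolding borel_prod lborel_prod by simp_all
    have sec: "Pair x -` A \<in> sets borel" for x
      using sets_Pair1[OF A'(1)] by simp
    have "map_prod \<phi> \<psi> -` A \<in> sets borel"
      using measurable_sets[OF m A] by simp
    then have B: "map_prod \<phi> \<psi> -` A \<in> sets (lborel \<Otimes>\<^sub>M lborel)"
      unfolding lborel_prod by simp
    have *: "Pair x -` (map_prod \<phi> \<psi> -` A) = \<psi> -` (Pair (\<phi> x) -` A)" for x
      by auto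
    have "(\<lambda>x. emeasure lborel (Pair x -` A)) \<in> borel_measurable lborel"
      using A'(2) by (rule lborel.measurable_emeasure_Pair)
    then have g[measurable]: "(\<lambda>x. emeasure lborel (Pair x -` A)) \<in> borel_measurable borel"
      by simp
    have "emeasure lborel (map_prod \<phi> \<psi> -` A) = emeasure (lborel \<Otimes>\<^sub>M lborel) (map_prod \<phi> \<psi> -` A)"
      by (simp add: lborel_prod)
    also have "\<dots> = (\<integral>\<^sup>+x. ennreal l * emeasure lborel (Pair (\<phi> x) -` A) \<partial>lborel)"
      by (subst lborel.emeasure_pair_measure_alt[OF B]) (simp add: * \<psi>[OF sec])
    also have "\<dots> = ennreal l * (\<integral>\<^sup>+x. emeasure lborel (Pair (\<phi> x) -` A) \<partial>lborel)"
      by (rule nn_integral_cmult) (use measurable_compose[OF _ g, of \<phi> lborel] in simp)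
    also have "(\<integral>\<^sup>+x. emeasure lborel (Pair (\<phi> x) -` A) \<partial>lborel)
        = (\<integral>\<^sup>+x. emeasure lborel (Pair x -` A) \<partial>distr lborel borel \<phi>)"
      by (rule nn_integral_distr[symmetric]) auto
    also have "\<dots> = ennreal k * (\<integral>\<^sup>+x. emeasure lborel (Pair x -` A) \<partial>lborel)"
      unfolding d by (rule nn_integral_scale_measure) simp
    also have "(\<integral>\<^sup>+x. emeasure lborel (Pair x -` A) \<partial>lborel) = emeasure lborel A"
      by (subst lborel.emeasure_pair_measure_alt[OF A'(2), symmetric]) (simp add: lborel_prod)
    finally show "emeasure lborel (map_prod \<phi> \<psi> -` A) = ennreal (k * l) * emeasure lborel A"
      using kl by (simp add: ennreal_mult mult_ac)
  qed (use kl in simp)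
qed

text \<open>The hypothesis \<open>sub\<close> compares successive increments, and
  \<open>p \<le> 1/2\<close> makes them nondecreasing from the first nonnegative one on. A single
  positive increment would therefore force linear growth against the bound \<open>C\<close>, so
  \<open>e\<close> never increases.\<close>

lemma bounded_subharmonic_le_start:
  fixes e :: "nat \<Rightarrow> real"
  assumes bnd: "\<And>k. e k \<le> C"
    and p: "0 < p" "p \<le> 1/2"
    and sub: "\<And>k. e (Suc k) \<le> p * e (Suc (Suc k)) + (1 - p) * e k"
  shows "e k \<le> e 0"
proof -
  have step: "e (Suc (Suc k)) - e (Suc k) \<ge> e (Suc k) - e k" if "e (Suc k) - e k \<ge> 0" for k
  proof -
    have "p * (e (Suc k) - e k) \<le> (1 - p) * (e (Suc k) - e k)"
      using p that by (intro mult_right_mono) auto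
    also have "\<dots> \<le> p * (e (Suc (Suc k)) - e (Suc k))"
      using sub[of k] by (simp add: algebra_simps)
    finally show ?thesis using p by simp
  qed
  have noninc: "e (Suc k) \<le> e k" for k
  proof (rule ccontr)
    assume inc: "\<not> ?thesis"
    define d where "d = e (Suc k) - e k"
    have "d > 0" using inc by (simp add: d_def)
    have inc: "e (Suc (k + n)) - e (k + n) \<ge> d" for n
    proof (induction n)
      case (Suc n)
      with step[of "k + n"] \<open>d > 0\<close> show ?case by simp
    qed (simp add: d_def)
    have grow: "e (k + n) \<ge> e k + real n * d" for n
    proof (induction n)
      case (Suc n)
      with inc[of n] show ?case by (simp add: algebra_simps)
    qed simp
    obtain n where "real n * d > C - e k"
      using reals_Archimedean3[OF \<open>d > 0\<close>] by blast
    with grow[of n] bnd[of "k + n"] show False by simp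
  qed
  show ?thesis
    by (induction k) (use noninc order_trans in \<open>blast+\<close>)
qed

section \<open>Geometry of the baker maps\<close>

lemma grid_cell_unique:
  fixes c x :: real
  assumes "c > 0" "(real i - 1) * c \<le> x" "x < real i * c" "(real j - 1) * c \<le> x" "x < real j * c"
  shows "i = j"
proof -
  have "(real i - 1) * c < real j * c" "(real j - 1) * c < real i * c"
    using assms by linarith+
  then have "real i - 1 < real j" "real j - 1 < real i"
    using assms(1) by (auto simp: mult_less_cancel_right)
  then show ?thesis by linarith
qed

lemma grid_cell_exists:
  fixes c x :: real
  assumes "c > 0" "0 \<le> x" "x < real m * c"
  shows "\<exists>i\<in>{1..m}. (real i - 1) * c \<le> x \<and> x < real i * c"
proof -
  define i where "i = nat \<lfloor>x / c\<rfloor> + 1"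
  have xc: "0 \<le> x / c" "x / c < real m"
    using assms by (auto simp: field_simps)
  have "real i - 1 \<le> x / c" "x / c < real i" "real i - 1 < real m"
    using xc unfolding i_def by linarith+
  then show ?thesis
    using assms(1) by (intro bexI[of _ i]) (auto simp: field_simps i_def)
qed

text \<open>Open cell against closed cell: this asymmetry later separates the open image box of one
  symbol from the closed image box of another.\<close>

lemma grid_cells_disjoint:
  fixes c y :: real
  assumes "c > 0" "(real i - 1) * c < y" "y < real i * c" "(real j - 1) * c \<le> y" "y \<le> real j * c"
  shows "i = j"
proof -
  have "(real i - 1) * c < real j * c" "(real j - 1) * c < real i * c"
    using assms by linarith+
  then have "real i - 1 < real j" "real j - 1 < real i"
    using assms(1) by (auto simp: mult_less_cancel_right)
  then show ?thesis by linarith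
qed

locale heterochaos =
  fixes m :: nat and a :: real
  assumes m_ge_2: "m \<ge> 2" and a_pos: "0 < a" and a_le: "a \<le> 1 / (2 * real m)"
begin

text \<open>The fibre parameter of \<open>g\<close>. It satisfies \<open>1 - m * b = m * a\<close>,
  so the heights \<open>m * a\<close> (once) and \<open>b\<close> (\<open>m\<close> times) fill the
  unit interval.\<close>

definition b :: real where "b = 1 / real m - a"
abbreviation f :: "real \<times> real \<Rightarrow> real \<times> real" where "f \<equiv> baker2 m a"
abbreviation g :: "(real \<times> real) \<times> real \<Rightarrow> (real \<times> real) \<times> real" where "g \<equiv> baker_g m a"

text \<open>\<open>a_le_beta\<close> says that the weight \<open>1 - m * a\<close> of the
  \<beta>-strip dominates the weight \<open>a\<close> of a single \<alpha>-strip, so that it can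
  serve as a common contraction factor.\<close>

lemma m_pos: "0 < real m" and m_a_pos: "0 < m * a" and m_a_le: "m * a \<le> 1 / 2"
  and m_b: "m * b = 1 - m * a" and b_pos: "0 < b" and a_le_beta: "a \<le> 1 - m * a"
proof -
  show "0 < real m" using m_ge_2 by simp
  then show "0 < m * a" using a_pos by simp
  show ma: "m * a \<le> 1 / 2" using a_le \<open>0 < real m\<close> by (simp add: field_simps)
  show mb: "m * b = 1 - m * a" using \<open>0 < real m\<close> by (simp add: b_def field_simps)
  then have "0 < m * b" using ma by linarith
  then show "0 < b" using \<open>0 < real m\<close> zero_less_mult_pos by blast
  have "2 * a \<le> m * a" using m_ge_2 a_pos by (intro mult_right_mono) auto
  then show "a \<le> 1 - m * a" using ma by linarith
qed

text \<open>Each branch is extended to a total affine map, in the shape \<open>t + c * x\<close> of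
  \<open>scales_affine\<close>, so that preimages can be computed on the whole plane without case
  distinctions.\<close>

definition branch2 :: "symb \<Rightarrow> real \<times> real \<Rightarrow> real \<times> real" where
  "branch2 \<gamma> = (case \<gamma> of
     Alpha i \<Rightarrow> map_prod (\<lambda>x. - (real i - 1) + (1 / a) * x) (\<lambda>y. (real i - 1) / m + (1 / m) * y)
   | Beta i \<Rightarrow> map_prod (\<lambda>x. - (real m * a / (1 - real m * a)) + (1 / (1 - real m * a)) * x)
       (\<lambda>y. (1 - real i) + real m * y))"

text \<open>The summand \<open>0\<close> keeps the \<alpha>-case in the shape of
  \<open>scales_affine\<close>; the factor \<open>m * a\<close> there is
  \<open>1 - m * b\<close>.\<close>

definition fibre :: "symb \<Rightarrow> real \<Rightarrow> real" where
  "fibre \<gamma> = (case \<gamma> of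
     Alpha i \<Rightarrow> (\<lambda>z. 0 + m * a * z)
   | Beta i \<Rightarrow> (\<lambda>z. (1 - b * (real m + 1 - real i)) + b * z))"

definition branch3 :: "symb \<Rightarrow> (real \<times> real) \<times> real \<Rightarrow> (real \<times> real) \<times> real" where
  "branch3 \<gamma> = map_prod (branch2 \<gamma>) (fibre \<gamma>)"

section \<open>Partition of the square and affine form of the maps\<close>

lemma Omega_plus_unique:
  assumes "\<gamma> \<in> alphabet m" "\<delta> \<in> alphabet m" "p \<in> Omega_plus m a \<gamma>" "p \<in> Omega_plus m a \<delta>"
  shows "\<gamma> = \<delta>"
proof -
  obtain x y where p: "p = (x, y)" by fastforce
  have ia: "real i * a \<le> m * a" if "i \<le> m" for i
    using that a_pos by simp
  \<comment> \<open>The topmost \<beta>-box is closed above, hence not a grid cell of the half-open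
    kind; \<open>top\<close> compares it with the others.\<close>
  have top: "i = m" if "i \<in> {1..m}" "y < real i / m" "(real m - 1) / m \<le> y" for i
  proof -
    have "(real m - 1) / m < real i / m" using that by linarith
    then show ?thesis using that m_pos by (simp add: divide_less_cancel)
  qed
  show ?thesis
  proof (cases \<gamma>; cases \<delta>)
    fix i j assume "\<gamma> = Alpha i" "\<delta> = Alpha j"
    then show ?thesis using assms p grid_cell_unique[OF a_pos, of i x j] by auto
  next
    fix i j assume "\<gamma> = Alpha i" "\<delta> = Beta j"
    then show ?thesis using assms p ia[of i] by (auto simp: alphabet_def)
  next
    fix i j assume "\<gamma> = Beta i" "\<delta> = Alpha j"
    then show ?thesis using assms p ia[of j] by (auto simp: alphabet_def)
  next
    fix i j assume "\<gamma> = Beta i" "\<delta> = Beta j"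
    then show ?thesis
      using assms p grid_cell_unique[of "1 / m" i y j] m_pos top[of i] top[of j]
      by (auto simp: alphabet_def split: if_splits)
  qed
qed

lemma symbol_of_eq:
  assumes "\<gamma> \<in> alphabet m" "p \<in> Omega_plus m a \<gamma>"
  shows "symbol_of m a p = \<gamma>"
  unfolding symbol_of_def using assms Omega_plus_unique by blast

lemma Omega_plus_cover:
  assumes "p \<in> unit_square"
  obtains \<gamma> where "\<gamma> \<in> alphabet m" "p \<in> Omega_plus m a \<gamma>"
proof -
  obtain x y where p: "p = (x, y)" by fastforce
  have xy: "0 \<le> x" "x \<le> 1" "0 \<le> y" "y \<le> 1" using assms p by (auto simp: unit_square_def)
  show ?thesis
  proof (cases "x < m * a")
    case True
    then obtain i where "i \<in> {1..m}" "(real i - 1) * a \<le> x" "x < real i * a"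
      using grid_cell_exists[OF a_pos xy(1)] by blast
    then show ?thesis using that[of "Alpha i"] p xy by (auto simp: alphabet_def)
  next
    case False
    show ?thesis
    proof (cases "y < 1")
      case True
      then obtain i where i: "i \<in> {1..m}" "(real i - 1) * (1 / m) \<le> y" "y < real i * (1 / m)"
        using grid_cell_exists[of "1 / m" y m] m_pos xy by auto
      then have "(x, y) \<in> Omega_plus m a (Beta i)" using xy False by auto
      then show ?thesis using that[of "Beta i"] p i by (simp add: alphabet_def)
    next
      case y: False
      then show ?thesis using that[of "Beta m"] p xy False m_ge_2
        by (auto simp: alphabet_def divide_simps)
    qed
  qed
qed

lemma baker2_branch:
  assumes "\<gamma> \<in> alphabet m" "p \<in> Omega_plus m a \<gamma>"
  shows "f p = branch2 \<gamma> p"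
proof -
  obtain x y where p: "p = (x, y)" by fastforce
  show ?thesis
  proof (cases \<gamma>)
    case (Alpha i)
    then have i: "i \<in> {1..m}" and x: "x \<in> {(real i - 1) * a..<real i * a}"
      using assms p by (auto simp: alphabet_def)
    have "real i * a \<le> m * a" using i a_pos by simp
    then have "x < m * a" using x by auto
    moreover have "(THE i. i \<in> {1..m} \<and> x \<in> {(real i - 1) * a..<real i * a}) = i"
      using i x grid_cell_unique[OF a_pos, of _ x i] by (intro the_equality) auto
    ultimately have "tau m a x = (x - (real i - 1) * a) / a"
      by (simp add: tau_def Let_def)
    then show ?thesis
      using symbol_of_eq[OF assms] Alpha p a_pos m_pos
      by (simp add: baker2_def branch2_def field_simps)
  next
    case (Beta i)
    then have "\<not> x < m * a" using assms p by auto
    then have "tau m a x = (x - m * a) / (1 - m * a)" by (simp add: tau_def)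
    then show ?thesis
      using symbol_of_eq[OF assms] Beta p m_a_le
      by (simp add: baker2_def branch2_def diff_divide_distrib)
  qed
qed

lemma baker_g_branch:
  assumes "\<gamma> \<in> alphabet m" "q \<in> Omega m a \<gamma>"
  shows "g q = branch3 \<gamma> q"
proof -
  obtain p z where q: "q = (p, z)" by fastforce
  then have p: "p \<in> Omega_plus m a \<gamma>" using assms by (auto simp: Omega_def)
  have *: "1 - m * b = m * a" using m_b by linarith
  show ?thesis
  proof (cases \<gamma>)
    case (Alpha i)
    then show ?thesis
      using symbol_of_eq[OF assms(1) p] baker2_branch[OF assms(1) p] q
      by (simp add: baker_g_def b_def[symmetric] baker3_def branch3_def fibre_def *)
  next
    case (Beta i)
    then show ?thesis
      using symbol_of_eq[OF assms(1) p] baker2_branch[OF assms(1) p] q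
      by (simp add: baker_g_def b_def[symmetric] baker3_def branch3_def fibre_def algebra_simps)
  qed
qed

lemma baker_g_fst: "fst (g q) = f (fst q)"
  by (cases q) (simp add: baker_g_def baker3_def split: symb.split)

section \<open>Open boxes and their images\<close>

definition U :: "symb \<Rightarrow> ((real \<times> real) \<times> real) set" where
  "U \<gamma> = (case \<gamma> of
     Alpha i \<Rightarrow> ({(real i - 1) * a<..<real i * a} \<times> {0<..<1}) \<times> {0<..<1}
   | Beta i \<Rightarrow> ({m * a<..<1} \<times> {(real i - 1) / m<..<real i / m}) \<times> {0<..<1})"

text \<open>The image of \<open>U \<gamma>\<close> under its branch: the \<alpha>-images lie side by
  side in \<open>y\<close> below height \<open>m * a\<close>, the \<beta>-images are stacked in
  \<open>z\<close> above it with thickness \<open>b\<close> each.\<close>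

definition R :: "symb \<Rightarrow> ((real \<times> real) \<times> real) set" where
  "R \<gamma> = (case \<gamma> of
     Alpha i \<Rightarrow> ({0<..<1} \<times> {(real i - 1) / m<..<real i / m}) \<times> {0<..<m * a}
   | Beta i \<Rightarrow> ({0<..<1} \<times> {0<..<1}) \<times> {1 - b * (real m + 1 - real i)<..<1 - b * (real m - real i)})"

text \<open>The closed box, which also catches the images of boundary points of
  \<open>Omega m a \<gamma>\<close>.\<close>

definition Rc :: "symb \<Rightarrow> ((real \<times> real) \<times> real) set" where
  "Rc \<gamma> = (case \<gamma> of
     Alpha i \<Rightarrow> ({0..1} \<times> {(real i - 1) / m..real i / m}) \<times> {0..m * a}
   | Beta i \<Rightarrow> ({0..1} \<times> {0..1}) \<times> {1 - b * (real m + 1 - real i)..1 - b * (real m - real i)})"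

lemma interior_Omega:
  assumes "\<gamma> \<in> alphabet m"
  shows "interior (Omega m a \<gamma>) = U \<gamma>"
  using m_pos
  by (cases \<gamma>) (auto simp: Omega_def U_def interior_Times)

text \<open>An equivalence for every \<open>q\<close>, since the branch is a total affine bijection:
  \<open>U \<gamma>\<close> is the full preimage of \<open>R \<gamma>\<close>, so that its volume
  follows from \<open>scales\<close>.\<close>

lemma branch3_in_R_iff: "branch3 \<gamma> q \<in> R \<gamma> \<longleftrightarrow> q \<in> U \<gamma>"
proof -
  obtain x y z where q: "q = ((x, y), z)" by (metis surj_pair)
  show ?thesis
  proof (cases \<gamma>)
    case (Alpha i)
    have "(0 < - (real i - 1) + (1 / a) * x \<and> - (real i - 1) + (1 / a) * x < 1)
        \<longleftrightarrow> (real i - 1) * a < x \<and> x < real i * a"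
      using a_pos by (auto simp: field_simps)
    moreover have "((real i - 1) / m < (real i - 1) / m + (1 / m) * y
        \<and> (real i - 1) / m + (1 / m) * y < real i / m) \<longleftrightarrow> 0 < y \<and> y < 1"
      using m_pos by (auto simp: field_simps)
    moreover have "0 < m * a * z \<longleftrightarrow> 0 < z"
      using mult_less_cancel_left_pos[OF m_a_pos, of 0 z] by (simp only: mult_zero_right)
    moreover have "m * a * z < m * a \<longleftrightarrow> z < 1"
      using mult_less_cancel_left_pos[OF m_a_pos, of z 1] by (simp only: mult_1_right)
    ultimately show ?thesis
      using Alpha q unfolding branch3_def branch2_def fibre_def R_def U_def
      by (simp only: symb.case map_prod_simp mem_Times_iff fst_conv snd_conv
          greaterThanLessThan_iff add_0)
  next
    case (Beta i)
    have c: "1 - m * a > 0" using m_a_le by linarith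
    have "- (m * a / (1 - m * a)) + (1 / (1 - m * a)) * x = (x - m * a) / (1 - m * a)"
      by (simp add: diff_divide_distrib)
    then have x: "(0 < - (m * a / (1 - m * a)) + (1 / (1 - m * a)) * x
        \<and> - (m * a / (1 - m * a)) + (1 / (1 - m * a)) * x < 1) \<longleftrightarrow> m * a < x \<and> x < 1"
      using c by (simp add: zero_less_divide_iff)
    have y: "(0 < (1 - real i) + m * y \<and> (1 - real i) + m * y < 1)
        \<longleftrightarrow> (real i - 1) / m < y \<and> y < real i / m"
      using m_pos by (auto simp: field_simps)
    have z0: "1 - b * (real m + 1 - real i) < (1 - b * (real m + 1 - real i)) + b * z \<longleftrightarrow> 0 < z"
      using zero_less_mult_iff[of b z] b_pos by linarith
    have "(1 - b * (real m + 1 - real i)) + b * z < 1 - b * (real m - real i) \<longleftrightarrow> b * z < b * 1"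
      by (simp add: algebra_simps)
    then have z1: "(1 - b * (real m + 1 - real i)) + b * z < 1 - b * (real m - real i) \<longleftrightarrow> z < 1"
      using b_pos by (simp only: mult_less_cancel_left_pos)
    show ?thesis
      using Beta q x y z0 z1 unfolding branch3_def branch2_def fibre_def R_def U_def
      by (simp only: symb.case map_prod_simp mem_Times_iff fst_conv snd_conv greaterThanLessThan_iff)
  qed
qed

lemma branch3_Omega:
  assumes "q \<in> Omega m a \<gamma>"
  shows "branch3 \<gamma> q \<in> Rc \<gamma>"
proof -
  obtain x y z where q: "q = ((x, y), z)" by (metis surj_pair)
  show ?thesis
  proof (cases \<gamma>)
    case (Alpha i)
    then show ?thesis
      using m_pos a_pos m_a_pos assms q
      by (auto simp: branch3_def branch2_def fibre_def Rc_def Omega_def field_simps)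
  next
    case (Beta i)
    have "1 - m * a > 0" using m_a_le by linarith
    have xyz: "m * a \<le> x" "x \<le> 1" "(real i - 1) / m \<le> y" "y \<le> real i / m" "0 \<le> z" "z \<le> 1"
      using assms q Beta m_pos by (auto simp: Omega_def split: if_splits)
    have "b * z \<le> b * 1" using b_pos xyz by (intro mult_left_mono) auto
    moreover have "b * (real m + 1 - real i) = b * (real m - real i) + b"
      by (simp add: algebra_simps)
    ultimately have "(1 - b * (real m + 1 - real i)) + b * z \<le> 1 - b * (real m - real i)"
      by linarith
    moreover have "- (m * a / (1 - m * a)) + (1 / (1 - m * a)) * x = (x - m * a) / (1 - m * a)"
      by (simp add: diff_divide_distrib)
    then have "0 \<le> - (m * a / (1 - m * a)) + (1 / (1 - m * a)) * x"
      "- (m * a / (1 - m * a)) + (1 / (1 - m * a)) * x \<le> 1"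
      using xyz \<open>1 - m * a > 0\<close> by simp_all
    moreover have "0 \<le> (1 - real i) + m * y" "(1 - real i) + m * y \<le> 1"
      using xyz m_pos \<open>1 - m * a > 0\<close> by (auto simp: field_simps)
    moreover have "0 \<le> b * z" using b_pos xyz by simp
    ultimately show ?thesis
      using Beta q by (auto simp: branch3_def branch2_def fibre_def Rc_def)
  qed
qed

text \<open>Since \<open>m * b = 1 - m * a\<close>, the \<beta>-slabs fit between the top
  \<open>m * a\<close> of the \<alpha>-images and the top of the cube.\<close>

lemma Beta_fibre_bounds:
  assumes "i \<in> {1..m}"
  shows "m * a \<le> 1 - b * (real m + 1 - real i)" "1 - b * (real m - real i) \<le> 1"
proof -
  have "b * (real m + 1 - real i) \<le> b * m" using b_pos assms by (intro mult_left_mono) auto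
  also have "\<dots> = 1 - m * a" using m_b by (simp add: mult.commute)
  finally show "m * a \<le> 1 - b * (real m + 1 - real i)" by simp
  show "1 - b * (real m - real i) \<le> 1" using b_pos assms by simp
qed

text \<open>Taking one box closed is what makes preimages unique: a point in the open image of one
  symbol cannot come from a boundary point of another symbol's box.\<close>

lemma R_Rc_disjoint:
  assumes "\<gamma> \<in> alphabet m" "\<delta> \<in> alphabet m" "q \<in> R \<gamma>" "q \<in> Rc \<delta>"
  shows "\<gamma> = \<delta>"
proof -
  obtain x y z where q: "q = ((x, y), z)" by (metis surj_pair)
  show ?thesis
  proof (cases \<gamma>; cases \<delta>)
    fix i j assume "\<gamma> = Alpha i" "\<delta> = Alpha j"
    then show ?thesis
      using assms q grid_cells_disjoint[of "1 / m" i y j] m_pos by (auto simp: R_def Rc_def)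
  next
    fix i j assume "\<gamma> = Alpha i" "\<delta> = Beta j"
    then show ?thesis
      using assms q Beta_fibre_bounds[of j] by (auto simp: R_def Rc_def alphabet_def)
  next
    fix i j assume "\<gamma> = Beta i" "\<delta> = Alpha j"
    then show ?thesis
      using assms q Beta_fibre_bounds[of i] by (auto simp: R_def Rc_def alphabet_def)
  next
    fix i j assume *: "\<gamma> = Beta i" "\<delta> = Beta j"
    then have "1 - b * (real m + 1 - real i) < 1 - b * (real m - real j)" "1 - b * (real m + 1 - real j) < 1 - b * (real m - real i)"
      using assms q by (auto simp: R_def Rc_def)
    then have "b * (real m - real j) < b * (real m + 1 - real i)" "b * (real m - real i) < b * (real m + 1 - real j)"
      by linarith+
    then have "real m - j < real m + 1 - i" "real m - i < real m + 1 - j"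
      using b_pos by (simp_all only: mult_less_cancel_left_pos)
    then show ?thesis using * by simp
  qed
qed

lemma finite_alphabet: "finite (alphabet m)"
  by (simp add: alphabet_def)

lemma R_subset_Rc: "R \<gamma> \<subseteq> Rc \<gamma>"
  by (cases \<gamma>) (auto simp: R_def Rc_def)

lemma Rc_subset_cube:
  assumes "\<gamma> \<in> alphabet m"
  shows "Rc \<gamma> \<subseteq> unit_cube"
proof (cases \<gamma>)
  case (Alpha i)
  then have i: "i \<in> {1..m}" using assms by (auto simp: alphabet_def)
  then have "0 \<le> (real i - 1) / m" "real i / m \<le> 1" by auto
  then show ?thesis
    using Alpha m_a_le by (auto simp: Rc_def unit_cube_def unit_square_def intro: order_trans)
next
  case (Beta i)
  then have i: "i \<in> {1..m}" using assms by (auto simp: alphabet_def)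
  from Beta_fibre_bounds[OF this] Beta m_a_pos show ?thesis
    by (fastforce simp: Rc_def unit_cube_def unit_square_def)
qed

lemma U_subset_Omega:
  assumes "\<gamma> \<in> alphabet m"
  shows "U \<gamma> \<subseteq> Omega m a \<gamma>"
  using interior_Omega[OF assms] interior_subset by metis

lemma Omega_plus_subset_square:
  assumes "\<gamma> \<in> alphabet m"
  shows "Omega_plus m a \<gamma> \<subseteq> unit_square"
proof (cases \<gamma>)
  case (Alpha i)
  then have i: "i \<in> {1..m}" using assms by (auto simp: alphabet_def)
  then have "real i * a \<le> m * a" "0 \<le> (real i - 1) * a" using a_pos by auto
  then show ?thesis
    using Alpha m_a_le by (auto simp: unit_square_def)
next
  case (Beta i)
  then have i: "i \<in> {1..m}" using assms by (auto simp: alphabet_def)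
  then have "0 \<le> (real i - 1) / m" "real i / m \<le> 1" "0 \<le> (real m - 1) / m" using m_ge_2 by auto
  then show ?thesis
    using Beta m_a_pos by (auto simp: unit_square_def intro: order_trans split: if_splits)
qed

lemma Omega_cover:
  assumes "q \<in> unit_cube"
  obtains \<gamma> where "\<gamma> \<in> alphabet m" "q \<in> Omega m a \<gamma>"
proof -
  from assms have "fst q \<in> unit_square" "snd q \<in> {0..1}"
    by (auto simp: unit_cube_def)
  then show thesis
    using Omega_plus_cover[of "fst q"] that by (metis Omega_def mem_Times_iff)
qed

lemma Omega_subset_cube:
  assumes "\<gamma> \<in> alphabet m"
  shows "Omega m a \<gamma> \<subseteq> unit_cube"
  using Omega_plus_subset_square[OF assms] by (auto simp: unit_cube_def Omega_def)

lemma baker_g_cube: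
  assumes "q \<in> unit_cube"
  shows "g q \<in> unit_cube"
proof -
  obtain \<gamma> where "\<gamma> \<in> alphabet m" "q \<in> Omega m a \<gamma>"
    using Omega_cover[OF assms] .
  then show ?thesis
    using baker_g_branch[of \<gamma> q] branch3_Omega[of q \<gamma>] Rc_subset_cube[of \<gamma>] by auto
qed

text \<open>\<open>g\<close> is not injective on the cube, as boundary points of different boxes can have the same image;
  but a point of an open box \<open>R \<gamma>\<close> has only one preimage in the whole cube.\<close>

lemma baker_g_in_R:
  assumes "q \<in> unit_cube" "\<gamma> \<in> alphabet m"
  shows "g q \<in> R \<gamma> \<longleftrightarrow> q \<in> U \<gamma>"
proof
  assume r: "g q \<in> R \<gamma>"
  obtain \<delta> where \<delta>: "\<delta> \<in> alphabet m" "q \<in> Omega m a \<delta>"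
    using Omega_cover[OF assms(1)] .
  then have gq: "g q = branch3 \<delta> q" "g q \<in> Rc \<delta>"
    using baker_g_branch branch3_Omega by auto
  then have "\<delta> = \<gamma>"
    using R_Rc_disjoint r assms \<delta> by blast
  then show "q \<in> U \<gamma>" using gq r branch3_in_R_iff by auto
next
  assume "q \<in> U \<gamma>"
  then show "g q \<in> R \<gamma>"
    using branch3_in_R_iff[of \<gamma> q] baker_g_branch[OF assms(2), of q] U_subset_Omega[OF assms(2)]
    by auto
qed

end

section \<open>Invariance of Lebesgue measure\<close>

lemma emeasure_lborel_Times:
  fixes A :: "'a::euclidean_space set" and B :: "'b::euclidean_space set"
  assumes "A \<in> sets borel" "B \<in> sets borel"
  shows "emeasure lborel (A \<times> B) = emeasure lborel A * emeasure lborel B"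
proof -
  have "emeasure (lborel \<Otimes>\<^sub>M lborel) (A \<times> B) = emeasure lborel A * emeasure lborel B"
    using assms by (intro lborel.emeasure_pair_measure_Times) auto
  then show ?thesis by (simp only: lborel_prod)
qed

lemma measure_preserving_iterate:
  assumes "measure_preserving_system M T"
  shows "T ^^ n \<in> measurable M M" "distr M M (T ^^ n) = M"
proof -
  have T: "T \<in> measurable M M" "distr M M T = M"
    using assms by (auto simp: measure_preserving_system_def)
  show Tn: "T ^^ n \<in> measurable M M" for n
  proof (induction n)
    case (Suc n)
    show ?case unfolding funpow_Suc_right using T(1) Suc by (rule measurable_comp)
  qed (simp add: id_def)
  show "distr M M (T ^^ n) = M"
  proof (induction n)
    case (Suc n)
    have "distr M M (T ^^ Suc n) = distr (distr M M T) M (T ^^ n)"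
      unfolding funpow_Suc_right by (rule distr_distr[OF Tn T(1), symmetric])
    then show ?case using T(2) Suc by (simp only:)
  qed (simp add: id_def distr_id2)
qed

lemma measure_preserving_emeasure:
  assumes "measure_preserving_system M T" "A \<in> sets M"
  shows "emeasure M ((T ^^ n) -` A \<inter> space M) = emeasure M A"
  using emeasure_distr[OF measure_preserving_iterate(1)[OF assms(1), of n] assms(2)]
    measure_preserving_iterate(2)[OF assms(1), of n] by simp

lemma measure_preserving_AE_iterate:
  assumes "measure_preserving_system M T" "AE x in M. P x"
  shows "AE x in M. \<forall>n. P ((T ^^ n) x)"
  unfolding AE_all_countable
proof
  fix n
  show "AE x in M. P ((T ^^ n) x)"
    using AE_distrD[OF measure_preserving_iterate(1)[OF assms(1), of n], of P]
      assms(2) unfolding measure_preserving_iterate(2)[OF assms(1), of n] by blast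
qed

lemma space_Leb_on [simp]: "space (Leb_on A) = A"
  by (simp add: Leb_on_def space_restrict_space)

lemma sets_Leb_on:
  assumes "A \<in> sets borel"
  shows "B \<in> sets (Leb_on A) \<longleftrightarrow> B \<in> sets borel \<and> B \<subseteq> A"
  using assms by (auto simp: Leb_on_def sets_restrict_space_iff)

lemma emeasure_Leb_on:
  assumes "A \<in> sets borel" "B \<subseteq> A"
  shows "emeasure (Leb_on A) B = emeasure lborel B"
  using assms by (auto simp: Leb_on_def intro: emeasure_restrict_space)

lemma measurable_Leb_onI:
  assumes "A \<in> sets borel" "\<And>x. x \<in> A \<Longrightarrow> F x \<in> A"
    and "\<And>B. B \<in> sets borel \<Longrightarrow> F -` B \<inter> A \<in> sets borel"
  shows "F \<in> measurable (Leb_on A) (Leb_on A)"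
proof (rule measurableI)
  fix B assume "B \<in> sets (Leb_on A)"
  then show "F -` B \<inter> space (Leb_on A) \<in> sets (Leb_on A)"
    using assms by (simp add: sets_Leb_on)
qed (use assms in auto)

lemma measurable_Leb_onD:
  assumes "A \<in> sets borel" "F \<in> measurable (Leb_on A) (Leb_on A)" "B \<in> sets borel"
  shows "F -` B \<inter> A \<in> sets borel"
proof -
  have "F -` (B \<inter> A) \<inter> space (Leb_on A) \<in> sets (Leb_on A)"
    using assms by (intro measurable_sets[OF assms(2)]) (auto simp: sets_Leb_on)
  moreover have "F -` (B \<inter> A) \<inter> space (Leb_on A) = F -` B \<inter> A"
    using measurable_space[OF assms(2)] by auto
  ultimately show ?thesis using assms(1) by (simp add: sets_Leb_on)
qed

lemma unit_square_borel [measurable]: "unit_square \<in> sets borel"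
  by (simp add: unit_square_def borel_closed closed_Times)

lemma unit_cube_borel [measurable]: "unit_cube \<in> sets borel"
  by (simp add: unit_cube_def unit_square_def borel_closed closed_Times)

lemma emeasure_unit_square: "emeasure lborel unit_square = 1"
  by (simp add: unit_square_def emeasure_lborel_Times)

lemma emeasure_unit_cube: "emeasure lborel unit_cube = 1"
  by (simp add: unit_cube_def emeasure_lborel_Times emeasure_unit_square)

lemma emeasure_subset_square_finite:
  assumes "X \<subseteq> unit_square"
  shows "emeasure lborel X \<noteq> \<infinity>"
proof -
  have "emeasure lborel X \<le> emeasure lborel unit_square"
    using assms by (intro emeasure_mono) auto
  then show ?thesis by (auto simp: emeasure_unit_square top_unique)
qed

lemma prob_space_Leb_on:
  assumes "A \<in> sets borel" "emeasure lborel A = 1"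
  shows "prob_space (Leb_on A)"
  by (rule prob_spaceI) (use assms in \<open>simp add: emeasure_Leb_on\<close>)

lemma AE_Leb_on:
  assumes "A \<in> sets borel"
  shows "(AE x in Leb_on A. P x) \<longleftrightarrow> (AE x in lborel. x \<in> A \<longrightarrow> P x)"
  using assms unfolding Leb_on_def by (subst AE_restrict_space_iff) auto

context heterochaos
begin

lemma branch2_scales:
  "scales (branch2 \<gamma>) (case \<gamma> of Alpha i \<Rightarrow> a * m | Beta i \<Rightarrow> (1 - m * a) / m)"
proof (cases \<gamma>)
  case (Alpha i)
  have "scales (branch2 \<gamma>) (1 / \<bar>1 / a\<bar> * (1 / \<bar>1 / real m\<bar>))"
    unfolding Alpha branch2_def symb.case
    using a_pos m_pos by (intro scales_map_prod scales_affine) auto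
  then show ?thesis using Alpha a_pos m_pos by simp
next
  case (Beta i)
  have *: "1 - m * a > 0" using m_a_le by linarith
  have "scales (branch2 \<gamma>) (1 / \<bar>1 / (1 - m * a)\<bar> * (1 / \<bar>real m\<bar>))"
    unfolding Beta branch2_def symb.case
    using * m_pos by (intro scales_map_prod scales_affine) auto
  then show ?thesis using Beta * by simp
qed

text \<open>The fibre factors \<open>m * a\<close> and \<open>b = (1 - m * a) / m\<close> cancel the
  planar Jacobians; this is where the value of \<open>b\<close> matters.\<close>

lemma branch3_scales: "scales (branch3 \<gamma>) 1"
proof (cases \<gamma>)
  case (Alpha i)
  have "scales (fibre \<gamma>) (1 / \<bar>m * a\<bar>)"
    unfolding Alpha fibre_def symb.case
    using m_pos a_pos by (intro scales_affine) auto
  with branch2_scales[of \<gamma>] Alpha have "scales (branch3 \<gamma>) (a * m * (1 / \<bar>m * a\<bar>))"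
    unfolding branch3_def by (intro scales_map_prod) auto
  moreover have "a * m * (1 / \<bar>m * a\<bar>) = 1"
    using a_pos m_pos by (simp add: abs_mult)
  ultimately show ?thesis by simp
next
  case (Beta i)
  have "scales (fibre \<gamma>) (1 / \<bar>b\<bar>)"
    unfolding Beta fibre_def symb.case
    using b_pos by (intro scales_affine) auto
  with branch2_scales[of \<gamma>] Beta have "scales (branch3 \<gamma>) ((1 - m * a) / m * (1 / \<bar>b\<bar>))"
    unfolding branch3_def by (intro scales_map_prod) auto
  moreover have "(1 - m * a) / m = b"
    using m_pos m_b by (simp add: field_simps)
  moreover have "b * (1 / \<bar>b\<bar>) = 1" using b_pos by simp
  ultimately show ?thesis by simp
qed

lemma branch_borel [measurable]:
  "branch2 \<gamma> \<in> borel_measurable borel" "branch3 \<gamma> \<in> borel_measurable borel"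
  using branch2_scales[of \<gamma>] branch3_scales[of \<gamma>] by (auto simp: scales_def)

section \<open>Box volumes and invariance under \<open>g\<close>\<close>

lemma boxes_borel [measurable]:
  "U \<gamma> \<in> sets borel" "R \<gamma> \<in> sets borel" "Omega_plus m a \<gamma> \<in> sets borel"
  "Omega m a \<gamma> \<in> sets borel"
proof -
  have "open (U \<gamma>)" "open (R \<gamma>)"
    by (cases \<gamma>; simp add: U_def R_def open_Times)+
  then show "U \<gamma> \<in> sets borel" "R \<gamma> \<in> sets borel" by (auto intro: borel_open)
  show *: "Omega_plus m a \<gamma> \<in> sets borel"
    by (cases \<gamma>) (auto intro: borel_Times)
  show "Omega m a \<gamma> \<in> sets borel"
    unfolding Omega_def using * by (intro borel_Times) auto
qed

text \<open>Two open sets of full measure in the cube between which \<open>g\<close> is a bijection: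
  \<open>V\<close> is the union of interiors from the definition of \<open>Lambda\<close>, and
  \<open>W\<close> is its image.\<close>

definition W :: "((real \<times> real) \<times> real) set" where "W = (\<Union>\<gamma>\<in>alphabet m. R \<gamma>)"
definition V :: "((real \<times> real) \<times> real) set" where "V = (\<Union>\<gamma>\<in>alphabet m. U \<gamma>)"

lemma W_V_borel [measurable]: "W \<in> sets borel" "V \<in> sets borel"
  using finite_alphabet by (auto simp: W_def V_def)

lemma W_V_subset_cube: "W \<subseteq> unit_cube" "V \<subseteq> unit_cube"
proof -
  show "W \<subseteq> unit_cube"
    using R_subset_Rc Rc_subset_cube unfolding W_def by blast
  show "V \<subseteq> unit_cube"
    using U_subset_Omega Omega_subset_cube unfolding V_def by blast
qed

lemma emeasure_R:
  assumes "\<gamma> \<in> alphabet m"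
  shows "emeasure lborel (R \<gamma>) = ennreal (case \<gamma> of Alpha i \<Rightarrow> a | Beta i \<Rightarrow> b)"
proof (cases \<gamma>)
  case (Alpha i)
  have "(real i - 1) / m \<le> real i / m" by (simp add: divide_right_mono)
  moreover have "real i / m - (real i - 1) / m = 1 / m"
    by (simp add: diff_divide_distrib)
  ultimately show ?thesis
    using Alpha m_a_pos m_pos a_pos
    by (simp add: R_def emeasure_lborel_Times borel_open open_Times ennreal_mult[symmetric])
next
  case (Beta i)
  have "b * (real m + 1 - real i) = b * (real m - real i) + b"
    by (simp add: algebra_simps)
  then have "emeasure lborel {1 - b * (real m + 1 - real i)<..<1 - b * (real m - real i)} = ennreal b"
    using b_pos by simp
  then show ?thesis
    using Beta by (simp add: R_def emeasure_lborel_Times borel_open open_Times)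
qed

lemma emeasure_U:
  assumes "\<gamma> \<in> alphabet m"
  shows "emeasure lborel (U \<gamma>) = emeasure lborel (R \<gamma>)"
proof -
  have "U \<gamma> = branch3 \<gamma> -` R \<gamma>" by (rule set_eqI) (simp add: branch3_in_R_iff)
  then show ?thesis using branch3_scales[of \<gamma>] by (simp add: scales_def)
qed

lemma disjoint_R: "disjoint_family_on R (alphabet m)"
  unfolding disjoint_family_on_def using R_Rc_disjoint R_subset_Rc by blast

lemma disjoint_U: "disjoint_family_on U (alphabet m)"
  unfolding disjoint_family_on_def
proof (intro ballI impI)
  fix \<gamma> \<delta> assume *: "\<gamma> \<in> alphabet m" "\<delta> \<in> alphabet m" "\<gamma> \<noteq> \<delta>"
  have "U \<gamma> \<subseteq> Omega m a \<gamma>" "U \<delta> \<subseteq> Omega m a \<delta>" using * U_subset_Omega by auto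
  moreover have "Omega m a \<gamma> \<inter> Omega m a \<delta> = {}"
    using * Omega_plus_unique by (auto simp: Omega_def)
  ultimately show "U \<gamma> \<inter> U \<delta> = {}" by blast
qed

text \<open>There are \<open>m\<close> boxes of volume \<open>a\<close> and \<open>m\<close> of
  volume \<open>b\<close>, and \<open>m * a + m * b = 1\<close>. As the boxes are disjoint and lie
  in the cube, their union misses only a null set.\<close>

lemma sum_emeasure_R: "(\<Sum>\<gamma>\<in>alphabet m. emeasure lborel (R \<gamma>)) = 1"
proof -
  have "(\<Sum>\<gamma>\<in>alphabet m. emeasure lborel (R \<gamma>))
      = ennreal (\<Sum>\<gamma>\<in>alphabet m. case \<gamma> of Alpha i \<Rightarrow> a | Beta i \<Rightarrow> b)"
    using a_pos b_pos by (simp add: emeasure_R) (subst sum_ennreal; auto split: symb.split)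
  also have "(\<Sum>\<gamma>\<in>alphabet m. case \<gamma> of Alpha i \<Rightarrow> a | Beta i \<Rightarrow> b) = m * a + m * b"
    unfolding alphabet_def
    by (subst sum.union_disjoint) (auto simp: sum.reindex inj_on_def)
  also have "\<dots> = 1" using m_b by linarith
  finally show ?thesis by simp
qed

lemma emeasure_W: "emeasure lborel W = 1"
  unfolding W_def
  by (subst sum_emeasure[symmetric])
    (use finite_alphabet disjoint_R sum_emeasure_R in auto)

lemma emeasure_V: "emeasure lborel V = 1"
  unfolding V_def
  by (subst sum_emeasure[symmetric])
    (use finite_alphabet disjoint_U sum_emeasure_R emeasure_U in auto)

lemma AE_cube_W_V: "AE q in lborel. q \<in> unit_cube \<longrightarrow> q \<in> W \<and> q \<in> V"
proof -
  have "emeasure lborel (unit_cube - W) = 0" "emeasure lborel (unit_cube - V) = 0"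
    using emeasure_Diff[of lborel W unit_cube] emeasure_Diff[of lborel V unit_cube] W_V_subset_cube
    by (simp_all add: emeasure_W emeasure_V emeasure_unit_cube)
  then have "unit_cube - W \<in> null_sets lborel" "unit_cube - V \<in> null_sets lborel"
    by (auto intro!: null_setsI)
  then have "AE q in lborel. q \<notin> unit_cube - W" "AE q in lborel. q \<notin> unit_cube - V"
    by (auto dest: AE_not_in)
  then show ?thesis by eventually_elim auto
qed

lemma baker_g_vimage_borel:
  assumes "A \<in> sets borel"
  shows "g -` A \<inter> unit_cube \<in> sets borel"
proof -
  have "g -` A \<inter> unit_cube = (\<Union>\<gamma>\<in>alphabet m. branch3 \<gamma> -` A \<inter> Omega m a \<gamma>)"
    (is "?l = ?r")
  proof
    show "?l \<subseteq> ?r"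
    proof
      fix q assume q: "q \<in> ?l"
      then obtain \<gamma> where "\<gamma> \<in> alphabet m" "q \<in> Omega m a \<gamma>"
        using Omega_cover by blast
      then show "q \<in> ?r" using q baker_g_branch[of \<gamma> q] by (intro UN_I[of \<gamma>]) simp_all
    qed
    show "?r \<subseteq> ?l"
    proof
      fix q assume "q \<in> ?r"
      then obtain \<gamma> where "\<gamma> \<in> alphabet m" "q \<in> Omega m a \<gamma>" "branch3 \<gamma> q \<in> A" by blast
      then show "q \<in> ?l" using baker_g_branch[of \<gamma> q] Omega_subset_cube[of \<gamma>] by auto
    qed
  qed
  moreover have "branch3 \<gamma> -` A \<in> sets borel" for \<gamma>
    using measurable_sets[OF branch_borel(2) assms, of \<gamma>] by simp
  ultimately show ?thesis using finite_alphabet by auto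
qed

text \<open>Up to null sets the preimage splits over the disjoint boxes \<open>U \<gamma>\<close>,
  each piece is carried to \<open>A \<inter> R \<gamma>\<close> without change of volume, and these
  pieces reassemble to \<open>A\<close>.\<close>

lemma emeasure_baker_g_vimage:
  assumes A: "A \<in> sets borel" "A \<subseteq> unit_cube"
  shows "emeasure lborel (g -` A \<inter> unit_cube) = emeasure lborel A"
proof -
  have sets: "branch3 \<gamma> -` (A \<inter> R \<gamma>) \<in> sets borel" for \<gamma>
    using measurable_sets[OF branch_borel(2), of "A \<inter> R \<gamma>" \<gamma>] A by simp
  \<comment> \<open>Intersecting with \<open>R \<gamma>\<close> localises the branch: the total
    affine map may send points far outside its own box into \<open>A\<close>.\<close>
  have iff: "q \<in> branch3 \<gamma> -` (A \<inter> R \<gamma>) \<longleftrightarrow> q \<in> U \<gamma> \<and> g q \<in> A" if "\<gamma> \<in> alphabet m" for q \<gamma>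
    using baker_g_branch[OF that, of q] U_subset_Omega[OF that] branch3_in_R_iff by auto
  have "emeasure lborel (g -` A \<inter> unit_cube)
      = emeasure lborel (\<Union>\<gamma>\<in>alphabet m. branch3 \<gamma> -` (A \<inter> R \<gamma>))"
  proof (rule emeasure_eq_AE)
    show "AE q in lborel. q \<in> g -` A \<inter> unit_cube
        \<longleftrightarrow> q \<in> (\<Union>\<gamma>\<in>alphabet m. branch3 \<gamma> -` (A \<inter> R \<gamma>))"
      using AE_cube_W_V
    proof eventually_elim
      case (elim q)
      then show ?case using iff W_V_subset_cube by (auto simp: V_def)
    qed
  qed (use A sets finite_alphabet baker_g_vimage_borel in auto)
  also have "\<dots> = (\<Sum>\<gamma>\<in>alphabet m. emeasure lborel (branch3 \<gamma> -` (A \<inter> R \<gamma>)))"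
  proof (rule sum_emeasure[symmetric])
    show "disjoint_family_on (\<lambda>\<gamma>. branch3 \<gamma> -` (A \<inter> R \<gamma>)) (alphabet m)"
      using disjoint_U iff unfolding disjoint_family_on_def by blast
  qed (use sets finite_alphabet in auto)
  also have "\<dots> = (\<Sum>\<gamma>\<in>alphabet m. emeasure lborel (A \<inter> R \<gamma>))"
    using branch3_scales A by (simp add: scales_def del: vimage_Int)
  also have "\<dots> = emeasure lborel (\<Union>\<gamma>\<in>alphabet m. A \<inter> R \<gamma>)"
  proof (rule sum_emeasure)
    show "disjoint_family_on (\<lambda>\<gamma>. A \<inter> R \<gamma>) (alphabet m)"
      using disjoint_R unfolding disjoint_family_on_def by blast
  qed (use A finite_alphabet in auto)
  also have "\<dots> = emeasure lborel A"
  proof (rule emeasure_eq_AE)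
    show "AE q in lborel. q \<in> (\<Union>\<gamma>\<in>alphabet m. A \<inter> R \<gamma>) \<longleftrightarrow> q \<in> A"
      using AE_cube_W_V
    proof eventually_elim
      case (elim q)
      then show ?case using A(2) by (auto simp: W_def)
    qed
  qed (use A finite_alphabet in auto)
  finally show ?thesis .
qed

lemma baker_g_measure_preserving: "measure_preserving_system (Leb_on unit_cube) g"
proof -
  have m: "g \<in> measurable (Leb_on unit_cube) (Leb_on unit_cube)"
    by (rule measurable_Leb_onI) (auto intro: baker_g_cube baker_g_vimage_borel)
  have "distr (Leb_on unit_cube) (Leb_on unit_cube) g = Leb_on unit_cube"
    by (rule measure_eqI)
      (auto simp: emeasure_distr[OF m] emeasure_Leb_on sets_Leb_on emeasure_baker_g_vimage)
  then show ?thesis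
    using m prob_space_Leb_on[OF unit_cube_borel emeasure_unit_cube]
    by (simp add: measure_preserving_system_def)
qed

section \<open>The factor map on the square\<close>

lemma baker2_square:
  assumes "p \<in> unit_square"
  shows "f p \<in> unit_square"
proof -
  have "g (p, 0) \<in> unit_cube"
    using assms by (intro baker_g_cube) (auto simp: unit_cube_def)
  then show ?thesis using baker_g_fst[of "(p, 0)"] by (auto simp: unit_cube_def)
qed

lemma baker2_vimage_borel:
  assumes "A \<in> sets borel"
  shows "f -` A \<inter> unit_square \<in> sets borel"
proof -
  have "f -` A \<inter> unit_square = (\<Union>\<gamma>\<in>alphabet m. branch2 \<gamma> -` A \<inter> Omega_plus m a \<gamma>)"
    (is "?l = ?r")
  proof
    show "?l \<subseteq> ?r"
    proof
      fix p assume p: "p \<in> ?l"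
      then obtain \<gamma> where "\<gamma> \<in> alphabet m" "p \<in> Omega_plus m a \<gamma>"
        using Omega_plus_cover by blast
      then show "p \<in> ?r" using p baker2_branch[of \<gamma> p] by (intro UN_I[of \<gamma>]) simp_all
    qed
    show "?r \<subseteq> ?l"
    proof
      fix p assume "p \<in> ?r"
      then obtain \<gamma> where "\<gamma> \<in> alphabet m" "p \<in> Omega_plus m a \<gamma>" "branch2 \<gamma> p \<in> A" by blast
      then show "p \<in> ?l" using baker2_branch[of \<gamma> p] Omega_plus_subset_square[of \<gamma>] by auto
    qed
  qed
  moreover have "branch2 \<gamma> -` A \<in> sets borel" for \<gamma>
    using measurable_sets[OF branch_borel(1) assms, of \<gamma>] by simp
  ultimately show ?thesis using finite_alphabet by auto
qed

text \<open>The branches of \<open>f\<close> have overlapping images and Jacobians other than 1, so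
  no single branch preserves area. Lifting \<open>A\<close> to the cylinder
  \<open>A \<times> {0..1}\<close> lets the invariance under \<open>g\<close> do the
  summation.\<close>

lemma emeasure_baker2_vimage:
  assumes A: "A \<in> sets borel" "A \<subseteq> unit_square"
  shows "emeasure lborel (f -` A \<inter> unit_square) = emeasure lborel A"
proof -
  have "A \<times> {0..1::real} \<in> sets borel"
    using A by (intro borel_Times) auto
  moreover have "A \<times> {0..1} \<subseteq> unit_cube"
    using A by (auto simp: unit_cube_def)
  ultimately have "emeasure lborel (g -` (A \<times> {0..1}) \<inter> unit_cube) = emeasure lborel (A \<times> {0..1::real})"
    by (rule emeasure_baker_g_vimage)
  moreover have "g -` (A \<times> {0..1}) \<inter> unit_cube = (f -` A \<inter> unit_square) \<times> {0..1}"
  proof (rule set_eqI)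
    fix q
    show "q \<in> g -` (A \<times> {0..1}) \<inter> unit_cube \<longleftrightarrow> q \<in> (f -` A \<inter> unit_square) \<times> {0..1}"
      using baker_g_fst[of q] baker_g_cube[of q] by (auto simp: unit_cube_def mem_Times_iff)
  qed
  ultimately show ?thesis
    using A baker2_vimage_borel[OF A(1)] by (simp add: emeasure_lborel_Times)
qed

lemma baker2_measure_preserving: "measure_preserving_system (Leb_on unit_square) f"
proof -
  have m: "f \<in> measurable (Leb_on unit_square) (Leb_on unit_square)"
    by (rule measurable_Leb_onI) (auto intro: baker2_square baker2_vimage_borel)
  have "distr (Leb_on unit_square) (Leb_on unit_square) f = Leb_on unit_square"
    by (rule measure_eqI)
      (auto simp: emeasure_distr[OF m] emeasure_Leb_on sets_Leb_on emeasure_baker2_vimage)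
  then show ?thesis
    using m prob_space_Leb_on[OF unit_square_borel emeasure_unit_square]
    by (simp add: measure_preserving_system_def)
qed

end

section \<open>Exactness\<close>

lemma measure_scales_vimage:
  assumes "scales \<phi> k" "A \<in> sets borel"
  shows "measure lborel (\<phi> -` A) = k * measure lborel A"
  using assms by (simp add: scales_def measure_def enn2real_mult)

section \<open>Base-\<open>m\<close> strips under the branches\<close>

context heterochaos
begin

text \<open>For \<open>r < m ^ k\<close> this is the set of \<open>y\<close> in [0,1) whose first
  \<open>k\<close> base-\<open>m\<close> digits, most significant first, are those of
  \<open>r\<close>.\<close>

definition J :: "nat \<Rightarrow> nat \<Rightarrow> real set" where
  "J k r = {real r / real m ^ k..<(real r + 1) / real m ^ k}"

lemma J_borel [measurable]: "J k r \<in> sets borel"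
  by (simp add: J_def)

lemma J_subset:
  assumes "r < m ^ k"
  shows "J k r \<subseteq> {0..<1}"
proof -
  have "real (r + 1) \<le> real (m ^ k)" using assms by (subst of_nat_le_iff) simp
  then have "(real r + 1) / real m ^ k \<le> 1" using m_pos by (simp add: divide_le_eq)
  moreover have "0 \<le> real r / real m ^ k" using m_pos by simp
  ultimately show ?thesis unfolding J_def by auto
qed

lemma measure_strip:
  assumes "branch2 \<gamma> -` Y \<subseteq> Omega_plus m a \<gamma>" "\<gamma> \<in> alphabet m" "A \<in> sets borel" "Y \<in> sets borel"
  shows "measure lborel (f -` A \<inter> branch2 \<gamma> -` Y)
    = (case \<gamma> of Alpha i \<Rightarrow> a * m | Beta i \<Rightarrow> (1 - m * a) / m) * measure lborel (A \<inter> Y)"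
proof -
  have "f p = branch2 \<gamma> p" if "branch2 \<gamma> p \<in> Y" for p
    using that assms baker2_branch by blast
  then have "f -` A \<inter> branch2 \<gamma> -` Y = branch2 \<gamma> -` (A \<inter> Y)" by auto
  then show ?thesis
    using measure_scales_vimage[OF branch2_scales, of "A \<inter> Y"] assms by simp
qed

text \<open>Symbol \<open>Alpha (Suc i)\<close> puts the digit \<open>i\<close> in front of
  \<open>y\<close>; in front of the \<open>k\<close> digits of \<open>r\<close> it has place value
  \<open>m ^ k\<close>, whence the index \<open>r + i * m ^ k\<close>.\<close>

lemma branch2_Alpha_vimage:
  assumes "i < m" "r < m ^ k"
  shows "branch2 (Alpha (Suc i)) -` ({0..<s} \<times> J (Suc k) (r + i * m ^ k))
    = {i * a..<(i + s) * a} \<times> J k r"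
proof (rule set_eqI)
  fix p :: "real \<times> real"
  obtain x y where p: "p = (x, y)" by fastforce
  have mk: "real m ^ k > 0" using m_pos by simp
  have x: "0 \<le> - (real (Suc i) - 1) + (1 / a) * x \<longleftrightarrow> i * a \<le> x"
    "- (real (Suc i) - 1) + (1 / a) * x < s \<longleftrightarrow> x < (i + s) * a"
    using a_pos by (auto simp: field_simps)
  have "real (r + i * m ^ k) / real m ^ Suc k = (real r / real m ^ k + i) / m"
    "(real (r + i * m ^ k) + 1) / real m ^ Suc k = ((real r + 1) / real m ^ k + i) / m"
    "(real (Suc i) - 1) / m + (1 / m) * y = (y + i) / m"
    using m_pos mk by (auto simp: field_simps)
  then have y: "real (r + i * m ^ k) / real m ^ Suc k \<le> (real (Suc i) - 1) / m + (1 / m) * y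
      \<longleftrightarrow> real r / real m ^ k \<le> y"
    "(real (Suc i) - 1) / m + (1 / m) * y < (real (r + i * m ^ k) + 1) / real m ^ Suc k
      \<longleftrightarrow> y < (real r + 1) / real m ^ k"
    using m_pos by (simp_all add: divide_le_cancel divide_less_cancel)
  show "p \<in> branch2 (Alpha (Suc i)) -` ({0..<s} \<times> J (Suc k) (r + i * m ^ k))
      \<longleftrightarrow> p \<in> {i * a..<(i + s) * a} \<times> J k r"
    unfolding p branch2_def J_def using x y by simp
qed

text \<open>The leading digit of \<open>r\<close> at level \<open>Suc l\<close> is
  \<open>r div m ^ l\<close>. It selects the \<beta>-symbol, and removing it leaves
  \<open>r mod m ^ l\<close>.\<close>

lemma branch2_Beta_vimage:
  assumes "r < m ^ Suc l"
  shows "branch2 (Beta (Suc (r div m ^ l))) -` ({0..<s} \<times> J l (r mod m ^ l))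
    = {m * a..<m * a + s * (1 - m * a)} \<times> J (Suc l) r"
proof (rule set_eqI)
  fix p :: "real \<times> real"
  obtain x y where p: "p = (x, y)" by fastforce
  define j where "j = r div m ^ l"
  define r' where "r' = r mod m ^ l"
  have r: "real r = real j * real m ^ l + real r'"
    unfolding j_def r'_def by (metis div_mult_mod_eq of_nat_add of_nat_mult of_nat_power)
  have ml: "real m ^ l > 0" using m_pos by simp
  have c: "1 - m * a > 0" using m_a_le by linarith
  have "- (m * a / (1 - m * a)) + (1 / (1 - m * a)) * x = (x - m * a) / (1 - m * a)"
    by (simp add: diff_divide_distrib)
  then have x: "0 \<le> - (m * a / (1 - m * a)) + (1 / (1 - m * a)) * x \<longleftrightarrow> m * a \<le> x"
    "- (m * a / (1 - m * a)) + (1 / (1 - m * a)) * x < s \<longleftrightarrow> x < m * a + s * (1 - m * a)"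
    using c by (auto simp: zero_le_divide_iff pos_divide_less_eq)
  have y: "real r' / real m ^ l \<le> (1 - real (Suc j)) + m * y \<longleftrightarrow> real r / real m ^ Suc l \<le> y"
    "(1 - real (Suc j)) + m * y < (real r' + 1) / real m ^ l
      \<longleftrightarrow> y < (real r + 1) / real m ^ Suc l"
    unfolding r using m_pos ml by (auto simp: field_simps)
  show "p \<in> branch2 (Beta (Suc (r div m ^ l))) -` ({0..<s} \<times> J l (r mod m ^ l))
      \<longleftrightarrow> p \<in> {m * a..<m * a + s * (1 - m * a)} \<times> J (Suc l) r"
    unfolding p branch2_def J_def j_def[symmetric] r'_def[symmetric] using x y by simp
qed

end

text \<open>\<open>A n\<close> is what the \<open>n\<close>-th preimage of a tail set looks like up to null sets; working modulo null sets
  lets the same argument serve the K-property, where equality only holds on \<open>Lambda\<close>.\<close>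

locale tail_sequence = heterochaos +
  fixes A :: "nat \<Rightarrow> (real \<times> real) set"
  assumes A_borel: "A n \<in> sets borel" and A_sub: "A n \<subseteq> unit_square"
    and A_step: "emeasure lborel (sym_diff (A n) (f -` A (Suc n) \<inter> unit_square)) = 0"
begin

lemma A_AE: "AE p in lborel. p \<in> A n \<longleftrightarrow> p \<in> f -` A (Suc n) \<inter> unit_square"
proof -
  have "sym_diff (A n) (f -` A (Suc n) \<inter> unit_square) \<in> null_sets lborel"
    using A_step[of n] A_borel[of n] baker2_vimage_borel[OF A_borel[of "Suc n"]]
    by (intro null_setsI) auto
  from AE_not_in[OF this] show ?thesis by eventually_elim auto
qed

lemma measure_A_step:
  assumes "X \<in> sets borel" "X \<subseteq> unit_square"
  shows "measure lborel (A n \<inter> X) = measure lborel (f -` A (Suc n) \<inter> X)"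
proof (rule measure_eq_AE)
  show "AE p in lborel. p \<in> A n \<inter> X \<longleftrightarrow> p \<in> f -` A (Suc n) \<inter> X"
    using A_AE[of n] by eventually_elim (use assms in auto)
  have "f -` A (Suc n) \<inter> X = (f -` A (Suc n) \<inter> unit_square) \<inter> X" using assms by auto
  then show "f -` A (Suc n) \<inter> X \<in> sets lborel"
    using baker2_vimage_borel[OF A_borel[of "Suc n"]] assms by simp
qed (use A_borel assms in auto)

section \<open>Deviation from independence on strips\<close>

definition c :: real where "c = measure lborel (A 0)"

lemma measure_A: "measure lborel (A n) = c"
proof (induction n)
  case (Suc n)
  have "measure lborel (A n) = measure lborel (f -` A (Suc n) \<inter> unit_square)"
    using measure_A_step[of unit_square n] A_sub[of n] by (simp add: Int_absorb2)
  also have "\<dots> = measure lborel (A (Suc n))"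
    using emeasure_baker2_vimage[OF A_borel A_sub] by (simp add: measure_def)
  finally show ?case using Suc by simp
qed (simp add: c_def)

lemma c_bounds: "0 \<le> c" "c \<le> 1"
proof -
  have "measure lborel (A 0) \<le> measure lborel unit_square"
    using emeasure_subset_square_finite A_borel[of 0] A_sub[of 0]
    by (intro measure_mono_fmeasurable) (auto simp: fmeasurable_def less_top)
  then show "c \<le> 1" by (simp add: c_def measure_def emeasure_unit_square)
qed (simp add: c_def)

text \<open>Deviation from independence on \<open>{0..<t} \<times> J k r\<close>, relative to the height of the rectangle.\<close>

definition dev :: "nat \<Rightarrow> real \<Rightarrow> nat \<Rightarrow> nat \<Rightarrow> real" where
  "dev n t k r = real m ^ k * measure lborel (A n \<inter> ({0..<t} \<times> J k r)) - c * t"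

lemma measure_split_x:
  assumes "0 \<le> u" "u \<le> v" "v \<le> 1" "r < m ^ k"
  shows "measure lborel (A n \<inter> ({0..<v} \<times> J k r))
    = measure lborel (A n \<inter> ({0..<u} \<times> J k r)) + measure lborel (A n \<inter> ({u..<v} \<times> J k r))"
proof -
  have "A n \<inter> ({0..<v} \<times> J k r) = A n \<inter> ({0..<u} \<times> J k r) \<union> A n \<inter> ({u..<v} \<times> J k r)"
    using assms by auto
  moreover have "measure lborel (A n \<inter> ({0..<u} \<times> J k r) \<union> A n \<inter> ({u..<v} \<times> J k r))
    = measure lborel (A n \<inter> ({0..<u} \<times> J k r)) + measure lborel (A n \<inter> ({u..<v} \<times> J k r))"
    using A_sub[of n] A_borel[of n]
    by (intro measure_Union emeasure_subset_square_finite) (auto intro!: sets.Int borel_Times)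
  ultimately show ?thesis by simp
qed

lemma rect_subset_square:
  assumes "0 \<le> u" "v \<le> 1" "r < m ^ k"
  shows "{u..<v} \<times> J k r \<subseteq> unit_square"
  using assms J_subset[OF assms(3)] by (auto simp: unit_square_def)

text \<open>On \<open>\<alpha>\<close>-strips \<open>f\<close> pushes a base-\<open>m\<close> digit onto \<open>y\<close>, on the \<open>\<beta>\<close>-strip it pops one.\<close>

lemma dev_alpha:
  assumes "i < m" "0 \<le> s" "s \<le> 1" "r < m ^ k"
  shows "dev n ((i + s) * a) k r = dev n (i * a) k r + a * dev (Suc n) s (Suc k) (r + i * m ^ k)"
proof -
  have mk: "real m ^ k > 0" using m_pos by simp
  have "real i + s \<le> m" using assms by linarith
  then have le: "(i + s) * a \<le> m * a" "i * a \<le> (i + s) * a" "0 \<le> i * a"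
    using a_pos assms by (auto intro: mult_right_mono)
  let ?Y = "{0..<s} \<times> J (Suc k) (r + i * m ^ k)"
  have Y: "?Y \<in> sets borel" by (intro borel_Times) auto
  let ?X = "{i * a..<(i + s) * a} \<times> J k r"
  have "(i + s) * a \<le> (real (Suc i)) * a"
    using assms a_pos by (intro mult_right_mono) auto
  then have sub: "?X \<subseteq> Omega_plus m a (Alpha (Suc i))"
    using J_subset[OF assms(4)] by auto
  have "measure lborel (A n \<inter> ?X) = measure lborel (f -` A (Suc n) \<inter> ?X)"
    using le m_a_le assms by (intro measure_A_step rect_subset_square borel_Times) auto
  also have "\<dots> = a * m * measure lborel (A (Suc n) \<inter> ?Y)"
    using measure_strip[of "Alpha (Suc i)" ?Y "A (Suc n)"] assms sub A_borel Y
    unfolding branch2_Alpha_vimage[OF assms(1,4)]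
    by (auto simp: alphabet_def)
  finally have "measure lborel (A n \<inter> ?X) = a * m * measure lborel (A (Suc n) \<inter> ?Y)" .
  moreover have "measure lborel (A n \<inter> ({0..<(i + s) * a} \<times> J k r))
      = measure lborel (A n \<inter> ({0..<i * a} \<times> J k r)) + measure lborel (A n \<inter> ?X)"
    using le m_a_le assms by (intro measure_split_x) auto
  ultimately show ?thesis by (simp add: dev_def algebra_simps)
qed

text \<open>The branch multiplies area by \<open>m / (1 - m * a)\<close>. Passing from level
  \<open>Suc l\<close> to \<open>l\<close> absorbs the \<open>m\<close> and leaves the weight
  \<open>1 - m * a\<close>; the term \<open>c * t\<close> splits in the same proportion, so no
  constant remains.\<close>

lemma dev_beta:
  assumes "0 \<le> s" "s \<le> 1" "r < m ^ Suc l"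
  shows "dev n (m * a + s * (1 - m * a)) (Suc l) r
    = dev n (m * a) (Suc l) r + (1 - m * a) * dev (Suc n) s l (r mod m ^ l)"
proof -
  let ?Y = "{0..<s} \<times> J l (r mod m ^ l)"
  have Y: "?Y \<in> sets borel" by (intro borel_Times) auto
  let ?v = "m * a + s * (1 - m * a)"
  let ?X = "{m * a..<?v} \<times> J (Suc l) r"
  let ?j = "Suc (r div m ^ l)"
  have c: "1 - m * a > 0" using m_a_le by linarith
  have "s * (1 - m * a) \<le> 1 * (1 - m * a)"
    using assms c by (intro mult_right_mono) auto
  moreover have "0 \<le> s * (1 - m * a)" using assms c by simp
  ultimately have le: "?v \<le> 1" "m * a \<le> ?v" by auto
  have j: "?j \<in> {1..m}"
    using assms(3) by (simp add: Suc_leI less_mult_imp_div_less)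
  have sub: "?X \<subseteq> Omega_plus m a (Beta ?j)"
  proof
    fix p assume p: "p \<in> ?X"
    obtain x y where xy: "p = (x, y)" by fastforce
    have "m * a \<le> x" "x \<le> 1" using p xy le by auto
    have "p \<in> branch2 (Beta ?j) -` ?Y" using p branch2_Beta_vimage[OF assms(3)] by auto
    then have "(1 - real ?j) + m * y \<in> {0..<1}"
      using J_subset[of "r mod m ^ l" l] m_ge_2 unfolding xy branch2_def by auto
    then have "(real ?j - 1) / m \<le> y" "y < real ?j / m"
      using m_pos by (auto simp: field_simps)
    then have "y \<in> (if ?j = m then {(real m - 1) / m..1} else {(real ?j - 1) / m..<real ?j / m})"
    proof (cases "?j = m")
      case True
      have "real m / m = 1" using m_pos by simp
      then show ?thesis
        using \<open>(real ?j - 1) / m \<le> y\<close> \<open>y < real ?j / m\<close> unfolding True by simp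
    qed simp
    then show "p \<in> Omega_plus m a (Beta ?j)"
      using \<open>m * a \<le> x\<close> \<open>x \<le> 1\<close> unfolding xy Omega_plus.simps by simp
  qed
  have "measure lborel (A n \<inter> ?X) = measure lborel (f -` A (Suc n) \<inter> ?X)"
    using le m_a_pos assms by (intro measure_A_step rect_subset_square borel_Times) auto
  also have "\<dots> = (1 - m * a) / m * measure lborel (A (Suc n) \<inter> ?Y)"
    using measure_strip[of "Beta ?j" ?Y "A (Suc n)"] j sub A_borel Y
    unfolding branch2_Beta_vimage[OF assms(3)]
    by (auto simp: alphabet_def)
  finally have "measure lborel (A n \<inter> ?X) = (1 - m * a) / m * measure lborel (A (Suc n) \<inter> ?Y)" .
  then have "real m ^ Suc l * measure lborel (A n \<inter> ?X)
      = (1 - m * a) * (real m ^ l * measure lborel (A (Suc n) \<inter> ?Y))"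
    using m_pos by simp
  moreover have "measure lborel (A n \<inter> ({0..<?v} \<times> J (Suc l) r))
      = measure lborel (A n \<inter> ({0..<m * a} \<times> J (Suc l) r)) + measure lborel (A n \<inter> ?X)"
    using le m_a_pos assms by (intro measure_split_x) auto
  ultimately show ?thesis
    by (simp only: dev_def distrib_left right_diff_distrib) (simp add: algebra_simps)
qed

lemma dev_0: "dev n 0 k r = 0"
  by (simp add: dev_def)

text \<open>The boundary value of the walk: at level 0 the strip misses only the edges
  \<open>x = 1\<close> and \<open>y = 1\<close> of the square, so it meets \<open>A n\<close> in
  measure \<open>c\<close>.\<close>

lemma dev_1_0: "dev n 1 0 0 = 0"
proof -
  have "A n \<inter> {0..<1} \<times> {0..<1} \<in> sets borel"
    using A_borel by (intro sets.Int borel_Times) auto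
  moreover have "AE p in lborel. p \<in> A n \<inter> {0..<1} \<times> {0..<1} \<longleftrightarrow> p \<in> A n"
  proof -
    have "{1::real} \<times> {0..1::real} \<in> null_sets lborel" "{0..1::real} \<times> {1::real} \<in> null_sets lborel"
      by (auto intro!: null_setsI borel_Times simp: emeasure_lborel_Times)
    then have "AE p in lborel. p \<notin> {1::real} \<times> {0..1::real}" "AE p in lborel. p \<notin> {0..1::real} \<times> {1::real}"
      by (auto dest: AE_not_in)
    then show ?thesis
    proof eventually_elim
      case (elim p)
      then show ?case using A_sub[of n] by (cases p) (fastforce simp: unit_square_def)
    qed
  qed
  ultimately have "measure lborel (A n \<inter> {0..<1} \<times> {0..<1}) = measure lborel (A n)"
    using A_borel by (intro measure_eq_AE) auto
  then show ?thesis by (simp add: dev_def J_def measure_A)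
qed

text \<open>Both terms of \<open>dev\<close> lie between 0 and \<open>t\<close>. The factor
  \<open>m ^ k\<close> just compensates the height of the strip, so the bound is uniform in the
  level.\<close>

lemma dev_bound:
  assumes "0 \<le> t" "t \<le> 1" "r < m ^ k"
  shows "\<bar>dev n t k r\<bar> \<le> 1"
proof -
  have mk: "real m ^ k > 0" using m_pos by simp
  have "measure lborel (A n \<inter> ({0..<t} \<times> J k r)) \<le> measure lborel ({0..<t} \<times> J k r)"
    using emeasure_subset_square_finite[OF rect_subset_square[of 0 t r k]] A_borel[of n] assms
    by (intro measure_mono_fmeasurable)
      (auto simp: fmeasurable_def less_top intro!: borel_Times sets.Int)
  also have "measure lborel ({0..<t} \<times> J k r) = t / real m ^ k"
    using assms mk
    by (simp add: measure_def emeasure_lborel_Times J_def ennreal_mult[symmetric]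
        divide_right_mono diff_divide_distrib[symmetric])
  finally have "real m ^ k * measure lborel (A n \<inter> ({0..<t} \<times> J k r)) \<le> t"
    using mk by (simp add: field_simps)
  moreover have "0 \<le> real m ^ k * measure lborel (A n \<inter> ({0..<t} \<times> J k r))" using mk by simp
  moreover have "0 \<le> c * t" using c_bounds assms by simp
  moreover have "c * t \<le> 1 * t" using c_bounds assms by (intro mult_right_mono)
  ultimately show ?thesis unfolding dev_def using assms by linarith
qed

end

lemma eucl_less_eq_Times: "{x. eucl_less x (t, s)} = {..<t} \<times> {..<s :: real}" for t :: real
  by (auto simp: eucl_less_def Basis_prod_def)

text \<open>Common form of the two triviality claims: a set of measure one is matched with the whole
  space, because its complement is null.\<close>

lemma eq_mod_null_trivial:
  assumes "\<And>C. C \<in> \<F> \<Longrightarrow> C \<in> sets M"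
    and "\<And>C. C \<in> \<F> \<Longrightarrow> emeasure M C = 0 \<or> emeasure M C = 1"
    and "\<And>E. E \<in> {space M, {}} \<Longrightarrow> E \<in> \<F>"
    and "prob_space M"
  shows "eq_mod_null M \<F> {space M, {}}"
  unfolding eq_mod_null_def subset_mod_null_def
proof (intro conjI ballI)
  interpret prob_space M by fact
  fix C assume C: "C \<in> \<F>"
  from assms(2)[OF C] show "\<exists>E\<in>{space M, {}}. emeasure M (sym_diff C E) = 0"
  proof
    assume "emeasure M C = 1"
    then have "emeasure M (space M - C) = 0"
      using assms(1)[OF C] by (simp add: emeasure_compl emeasure_space_1)
    moreover have "sym_diff C (space M) = space M - C"
      using sets.sets_into_space[OF assms(1)[OF C]] by auto
    ultimately show ?thesis by auto
  qed auto
next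
  fix E assume "E \<in> {space M, {}}"
  then show "\<exists>C\<in>\<F>. emeasure M (sym_diff E C) = 0"
    using assms(3) by (intro bexI[of _ E]) auto
qed

context tail_sequence
begin

text \<open>Repeated use of \<open>dev_alpha\<close> with \<open>s = 1\<close>: every complete
  \<alpha>-strip is stretched to full width, so only full-width deviations occur on the
  right.\<close>

lemma dev_strips:
  assumes "i \<le> m" "r < m ^ k"
  shows "dev n (real i * a) k r = (\<Sum>j<i. a * dev (Suc n) 1 (Suc k) (r + j * m ^ k))"
  using assms(1)
proof (induction i)
  case 0
  then show ?case by (simp add: dev_0)
next
  case (Suc i)
  have "dev n ((real i + 1) * a) k r
      = dev n (real i * a) k r + a * dev (Suc n) 1 (Suc k) (r + i * m ^ k)"
    using Suc assms(2) by (intro dev_alpha) auto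
  then show ?case using Suc by (simp add: add.commute)
qed

lemma push_index_less:
  fixes j r k :: nat
  assumes "j < m" "r < m ^ k"
  shows "r + j * m ^ k < m ^ Suc k"
proof -
  have "r + j * m ^ k < (j + 1) * m ^ k" using assms by simp
  also have "\<dots> \<le> m * m ^ k" using assms by (intro mult_right_mono) auto
  finally show ?thesis by simp
qed

text \<open>The supremum of \<open>\<bar>dev\<bar>\<close> over all full-width strips of level \<open>k\<close> is subharmonic for the walk on levels
  with upward probability \<open>m * a \<le> 1/2\<close> and vanishes at level \<open>0\<close>. This is where
  \<open>a \<le> 1 / (2 * m)\<close> enters.\<close>

lemma dev_full:
  assumes "r < m ^ k"
  shows "dev n 1 k r = 0"
proof -
  \<comment> \<open>The supremum also runs over \<open>n\<close>, since every step replaces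
    \<open>A n\<close> by \<open>A (Suc n)\<close>; \<open>e\<close> then depends on the level
    alone.\<close>
  define F where "F k = (\<lambda>(n, r). \<bar>dev n 1 k r\<bar>) ` (UNIV \<times> {..<m ^ k})" for k
  define e where "e k = Sup (F k)" for k
  have bdd: "bdd_above (F k)" for k
    unfolding F_def using dev_bound by (intro bdd_aboveI[of _ 1]) auto
  have ne: "F k \<noteq> {}" for k
  proof -
    have "0 \<in> {..<m ^ k}" using m_ge_2 by auto
    then show ?thesis unfolding F_def by blast
  qed
  have up: "\<bar>dev n 1 k r\<bar> \<le> e k" if "r < m ^ k" for n k r
    unfolding e_def using bdd that by (intro cSup_upper) (auto simp: F_def)
  have lo: "e k \<le> B" if "\<And>n r. r < m ^ k \<Longrightarrow> \<bar>dev n 1 k r\<bar> \<le> B" for k B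
    unfolding e_def using ne that by (intro cSup_least) (auto simp: F_def)
  have sub: "e (Suc l) \<le> (m * a) * e (Suc (Suc l)) + (1 - m * a) * e l" for l
  proof (rule lo)
    fix n r assume r: "r < m ^ Suc l"
    have "\<bar>dev n (m * a) (Suc l) r\<bar> \<le> (\<Sum>j<m. \<bar>a * dev (Suc n) 1 (Suc (Suc l)) (r + j * m ^ Suc l)\<bar>)"
      unfolding dev_strips[OF order_refl r] by (rule sum_abs)
    also have "\<dots> \<le> (\<Sum>j<m. a * e (Suc (Suc l)))"
      using a_pos up push_index_less r
      by (intro sum_mono) (simp add: abs_mult del: power_Suc)
    finally have 1: "\<bar>dev n (m * a) (Suc l) r\<bar> \<le> m * a * e (Suc (Suc l))" by simp
    have "r mod m ^ l < m ^ l" using m_ge_2 by simp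
    then have "(1 - m * a) * \<bar>dev (Suc n) 1 l (r mod m ^ l)\<bar> \<le> (1 - m * a) * e l"
      using up m_a_le by (intro mult_left_mono) auto
    moreover have "\<bar>(1 - m * a) * dev (Suc n) 1 l (r mod m ^ l)\<bar>
        = (1 - m * a) * \<bar>dev (Suc n) 1 l (r mod m ^ l)\<bar>"
      using m_a_le by (simp add: abs_mult)
    ultimately show "\<bar>dev n 1 (Suc l) r\<bar> \<le> (m * a) * e (Suc (Suc l)) + (1 - m * a) * e l"
      using dev_beta[of 1 r l n] r 1 by simp
  qed
  have "e k \<le> e 0"
  proof (rule bounded_subharmonic_le_start[where C=1 and p="m * a"])
    show "e k \<le> 1" for k using dev_bound by (intro lo) auto
  qed (use m_a_pos m_a_le sub in auto)
  also have "e 0 \<le> 0" by (rule lo) (simp add: dev_1_0)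
  finally show ?thesis using up[OF assms, of n] by linarith
qed

section \<open>From full-width strips to rectangles\<close>

lemma measure_split_y:
  assumes "0 \<le> t" "t \<le> 1" "r \<le> m ^ k"
  shows "measure lborel (A n \<inter> ({0..<t} \<times> {0..<real r / real m ^ k}))
    = (\<Sum>j<r. measure lborel (A n \<inter> ({0..<t} \<times> J k j)))"
  using assms(3)
proof (induction r)
  case (Suc r)
  have mk: "real m ^ k > 0" using m_pos by simp
  let ?P = "A n \<inter> ({0..<t} \<times> {0..<real r / real m ^ k})" and ?Q = "A n \<inter> ({0..<t} \<times> J k r)"
  have eq: "A n \<inter> ({0..<t} \<times> {0..<real (Suc r) / real m ^ k}) = ?P \<union> ?Q"
  proof -
    have "{0..<real (Suc r) / real m ^ k} = {0..<real r / real m ^ k} \<union> J k r"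
      unfolding J_def using mk
      by (subst ivl_disj_un_two(3)) (auto simp: divide_right_mono add.commute)
    then show ?thesis by auto
  qed
  have disj: "?P \<inter> ?Q = {}" by (auto simp: J_def)
  have "measure lborel (?P \<union> ?Q) = measure lborel ?P + measure lborel ?Q"
    using A_borel[of n] A_sub[of n]
    by (intro measure_Union emeasure_subset_square_finite disj) (auto intro!: sets.Int borel_Times)
  then show ?case using Suc eq by simp
qed simp

text \<open>At level 0 there is no digit for the \<beta>-strip to pop, so \<open>dev_beta\<close>
  does not apply. Averaging over the \<open>m\<close> strips of level 1 moves the estimate to a
  level where it does.\<close>

lemma dev_level_0:
  assumes "0 \<le> t" "t \<le> 1"
  shows "dev n t 0 0 = (\<Sum>j<m. dev n t 1 j) / m"
proof -
  have "measure lborel (A n \<inter> ({0..<t} \<times> {0..<1})) = (\<Sum>j<m. measure lborel (A n \<inter> ({0..<t} \<times> J 1 j)))"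
    using measure_split_y[of t m 1 n] assms m_pos by simp
  moreover have "(\<Sum>j<m. dev n t 1 j)
      = m * (\<Sum>j<m. measure lborel (A n \<inter> ({0..<t} \<times> J 1 j))) - m * (c * t)"
    by (simp add: dev_def sum_subtractf sum_distrib_left)
  ultimately show ?thesis
    using m_pos by (simp add: dev_def J_def field_simps)
qed

text \<open>A point \<open>t\<close> cuts only one of the \<open>x\<close>-strips and the others contribute \<open>0\<close>, so one step contracts
  the supremum of \<open>\<bar>dev\<bar>\<close> over all \<open>t\<close> by the factor \<open>1 - m * a\<close>.\<close>

lemma dev_eq_0:
  assumes "0 \<le> t" "t \<le> 1" "r < m ^ k"
  shows "dev n t k r = 0"
proof -
  define F where "F = (\<lambda>(n, t, k, r). \<bar>dev n t k r\<bar>) ` {(n, t, k, r). 0 \<le> t \<and> t \<le> 1 \<and> r < m ^ k}"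
  define E where "E = Sup F"
  have bdd: "bdd_above F"
    unfolding F_def using dev_bound by (intro bdd_aboveI[of _ 1]) auto
  have up: "\<bar>dev n t k r\<bar> \<le> E" if "0 \<le> t" "t \<le> 1" "r < m ^ k" for n t k r
    unfolding E_def F_def
    by (rule cSup_upper) (use bdd that in \<open>auto simp: F_def intro!: image_eqI[of _ _ "(n, t, k, r)"]\<close>)
  have "0 \<le> E" using up[of 0 0 0 0] by auto
  let ?q = "1 - m * a"
  have "?q > 0" using m_a_le by linarith
  have alpha: "\<bar>dev n t k r\<bar> \<le> ?q * E" if t: "0 \<le> t" "t < m * a" and r: "r < m ^ k" for n t k r
  proof -
    obtain i' where i': "i' \<in> {1..m}" "(real i' - 1) * a \<le> t" "t < real i' * a"
      using grid_cell_exists[OF a_pos t] by blast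
    \<comment> \<open>Symbols count from 1 and digits from 0. Below, \<open>s\<close> is the
      relative position of \<open>t\<close> within the \<alpha>-strip that contains it.\<close>
    define i where "i = i' - 1"
    have i: "i < m" "real i * a \<le> t" "t < (real i + 1) * a"
      using i' by (auto simp: i_def of_nat_diff)
    define s where "s = t / a - i"
    have s: "0 \<le> s" "s \<le> 1" "(i + s) * a = t"
      using i a_pos by (auto simp: s_def field_simps)
    have "dev n (real i * a) k r = 0"
    proof -
      have "dev (Suc n) 1 (Suc k) (r + j * m ^ k) = 0" if "j < i" for j
        using that i push_index_less r by (intro dev_full) auto
      then show ?thesis using dev_strips[of i r k n] i r by simp
    qed
    then have "\<bar>dev n t k r\<bar> = a * \<bar>dev (Suc n) s (Suc k) (r + i * m ^ k)\<bar>"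
      using dev_alpha[OF i(1) s(1,2) r, of n] s a_pos by (simp add: abs_mult)
    also have "\<dots> \<le> a * E"
      using up[OF s(1,2) push_index_less[OF i(1) r]] a_pos by (intro mult_left_mono) auto
    also have "\<dots> \<le> ?q * E"
      using a_le_beta \<open>0 \<le> E\<close> by (intro mult_right_mono) auto
    finally show ?thesis .
  qed
  have Suc: "\<bar>dev n t (Suc l) r\<bar> \<le> ?q * E" if t: "0 \<le> t" "t \<le> 1" and r: "r < m ^ Suc l" for n t l r
  proof (cases "t < m * a")
    case False
    define s where "s = (t - m * a) / ?q"
    have s: "0 \<le> s" "s \<le> 1" "m * a + s * ?q = t"
      using False t \<open>?q > 0\<close> by (auto simp: s_def divide_le_eq)
    have "r mod m ^ l < m ^ l" using m_ge_2 by simp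
    have "dev n (m * a) (Suc l) r = 0"
    proof -
      have "dev (Suc n) 1 (Suc (Suc l)) (r + j * m ^ Suc l) = 0" if "j < m" for j
        using that push_index_less r by (intro dev_full) blast
      then show ?thesis using dev_strips[OF order_refl r, of n] by simp
    qed
    then have "\<bar>dev n t (Suc l) r\<bar> = ?q * \<bar>dev (Suc n) s l (r mod m ^ l)\<bar>"
      using dev_beta[OF s(1,2) r, of n] s \<open>?q > 0\<close> by (simp add: abs_mult)
    also have "\<dots> \<le> ?q * E"
      using up[OF s(1,2) \<open>r mod m ^ l < m ^ l\<close>] \<open>?q > 0\<close> by (intro mult_left_mono) auto
    finally show ?thesis .
  qed (use alpha t r in auto)
  have "\<bar>dev n t k r\<bar> \<le> ?q * E" if t: "0 \<le> t" "t \<le> 1" and r: "r < m ^ k" for n t k r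
  proof (cases k)
    case 0
    have "\<bar>\<Sum>j<m. dev n t 1 j\<bar> \<le> (\<Sum>j<m. \<bar>dev n t 1 j\<bar>)" by (rule sum_abs)
    also have "\<dots> \<le> (\<Sum>j<m. ?q * E)"
      using Suc[OF t, of _ 0] by (intro sum_mono) simp
    finally have "\<bar>\<Sum>j<m. dev n t 1 j\<bar> \<le> m * (?q * E)" by simp
    then have "\<bar>(\<Sum>j<m. dev n t 1 j) / m\<bar> \<le> ?q * E"
      using m_pos by (simp add: abs_divide divide_le_eq mult.commute)
    moreover have "r = 0" using r 0 by simp
    ultimately show ?thesis using dev_level_0[OF t, of n] 0 by simp
  qed (use Suc t r in auto)
  moreover have "F \<noteq> {}"
    using assms unfolding F_def by auto
  ultimately have "E \<le> ?q * E"
    unfolding E_def by (intro cSup_least) (auto simp: F_def)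
  then have "m * a * E \<le> 0" by (simp add: algebra_simps)
  then have "E \<le> 0" using mult_pos_pos[OF m_a_pos, of E] by (cases "0 < E") auto
  then show ?thesis using up[OF assms, of n] by linarith
qed

text \<open>For \<open>m\<close>-adic \<open>s\<close> this is a sum of vanishing deviations. A
  general \<open>s\<close> is rounded down to a multiple of \<open>1 / m ^ k\<close>; the leftover
  rectangle has area at most \<open>1 / m ^ k\<close>, and \<open>k\<close> is arbitrary.\<close>

lemma measure_box:
  assumes t: "0 \<le> t" "t \<le> 1" and s: "0 \<le> s" "s \<le> 1"
  shows "measure lborel (A n \<inter> ({0..<t} \<times> {0..<s})) = c * t * s"
proof -
  let ?G = "\<lambda>s. measure lborel (A n \<inter> ({0..<t} \<times> {0..<s}))"
  have close: "\<bar>?G s - c * t * s\<bar> \<le> (1 / real m) ^ k" for k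
  proof -
    have mk: "real m ^ k > 0" using m_pos by simp
    define r where "r = nat \<lfloor>s * real m ^ k\<rfloor>"
    let ?u = "real r / real m ^ k"
    have "real r \<le> s * real m ^ k" "s * real m ^ k < real r + 1"
      using s mk by (auto simp: r_def)
    then have u: "?u \<le> s" "s \<le> ?u + 1 / real m ^ k" "0 \<le> ?u"
      using mk by (auto simp: field_simps)
    have "s * real m ^ k \<le> 1 * real m ^ k" using s mk by (intro mult_right_mono) auto
    then have "real r \<le> real m ^ k" using \<open>real r \<le> s * real m ^ k\<close> by linarith
    then have r: "r \<le> m ^ k" by (simp only: of_nat_power[symmetric] of_nat_le_iff)
    have "measure lborel (A n \<inter> ({0..<t} \<times> J k j)) = c * t / real m ^ k" if "j < r" for j
      using dev_eq_0[OF t, of j k n] that r mk by (simp add: dev_def field_simps)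
    then have G_u: "?G ?u = c * t * ?u"
      using measure_split_y[OF t r, of n] by simp
    let ?X = "A n \<inter> ({0..<t} \<times> {?u..<s})"
    have "{0..<s} = {0..<?u} \<union> {?u..<s}"
      by (rule ivl_disj_un_two(3)[symmetric]) (use u in auto)
    then have "A n \<inter> ({0..<t} \<times> {0..<s}) = A n \<inter> ({0..<t} \<times> {0..<?u}) \<union> ?X"
      by blast
    moreover have "measure lborel (A n \<inter> ({0..<t} \<times> {0..<?u}) \<union> ?X) = ?G ?u + measure lborel ?X"
      using A_borel[of n] A_sub[of n]
      by (intro measure_Union emeasure_subset_square_finite) (auto intro!: sets.Int borel_Times)
    ultimately have G_s: "?G s = ?G ?u + measure lborel ?X" by simp
    have "{?u..<s} \<subseteq> {0..1}"
    proof
      fix y assume "y \<in> {?u..<s}"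
      then have "?u \<le> y" "y < s" by simp_all
      then have "0 \<le> y" "y \<le> 1" using u(3) s by linarith+
      then show "y \<in> {0..1}" by simp
    qed
    then have "{0..<t} \<times> {?u..<s} \<subseteq> unit_square"
      using t by (auto simp: unit_square_def)
    then have "measure lborel ?X \<le> measure lborel ({0..<t} \<times> {?u..<s})"
      using A_borel[of n] emeasure_subset_square_finite[of "{0..<t} \<times> {?u..<s}"]
      by (intro measure_mono_fmeasurable)
        (auto simp: fmeasurable_def less_top intro!: borel_Times sets.Int)
    also have "\<dots> = t * (s - ?u)"
      using t u by (simp add: measure_def emeasure_lborel_Times ennreal_mult[symmetric])
    also have "\<dots> \<le> 1 * (1 / real m ^ k)"
      using t u by (intro mult_mono) auto
    finally have X: "measure lborel ?X \<le> 1 / real m ^ k" by simp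
    have "c * t * (s - ?u) \<le> 1 * (1 / real m ^ k)"
      using t u c_bounds mult_mono[of c 1 t 1] by (intro mult_mono) auto
    moreover have "0 \<le> c * t * (s - ?u)" using t u c_bounds by simp
    moreover have "?G s - c * t * s = measure lborel ?X - c * t * (s - ?u)"
      using G_s G_u by (simp add: algebra_simps)
    moreover have "0 \<le> measure lborel ?X" by simp
    ultimately have "\<bar>?G s - c * t * s\<bar> \<le> 1 / real m ^ k"
      using X by linarith
    then show ?thesis by (simp add: power_one_over)
  qed
  show ?thesis
  proof (rule ccontr)
    assume "?G s \<noteq> c * t * s"
    then have "0 < \<bar>?G s - c * t * s\<bar>" by simp
    moreover have "1 / real m < 1" using m_ge_2 by simp
    ultimately obtain k where "(1 / real m) ^ k < \<bar>?G s - c * t * s\<bar>"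
      using real_arch_pow_inv by blast
    with close[of k] show False by simp
  qed
qed

text \<open>\<open>M1\<close> and \<open>M2\<close> agree on lower-left quadrants by
  \<open>measure_box\<close>, and these form an intersection-stable generator of the Borel sets, so
  the two measures coincide. Evaluating them at \<open>A 0\<close> leaves
  \<open>c = c * c\<close>.\<close>

lemma zero_one: "c = 0 \<or> c = 1"
proof -
  let ?Q = "{0..<1::real} \<times> {0..<1::real}"
  have Q[measurable]: "?Q \<in> sets borel" by (intro borel_Times) auto
  define M1 where "M1 = density lborel (indicator (A 0 \<inter> ?Q))"
  define M2 where "M2 = scale_measure (ennreal c) (density lborel (indicator ?Q))"
  have AQ: "A 0 \<inter> ?Q \<in> sets borel" using A_borel[of 0] Q by (rule sets.Int)
  have M1: "emeasure M1 X = emeasure lborel (A 0 \<inter> ?Q \<inter> X)" if "X \<in> sets borel" for X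
    using that AQ unfolding M1_def by (simp only: emeasure_restricted sets_lborel)
  have M2: "emeasure M2 X = ennreal c * emeasure lborel (?Q \<inter> X)" if "X \<in> sets borel" for X
    using that Q unfolding M2_def
    by (simp only: emeasure_scale_measure emeasure_restricted sets_lborel)
  have fin: "emeasure lborel (A 0 \<inter> Y) = ennreal (measure lborel (A 0 \<inter> Y))" for Y
    using A_sub[of 0] emeasure_subset_square_finite[of "A 0 \<inter> Y"] by (intro emeasure_eq_ennreal_measure) auto
  have eq: "emeasure M1 X = emeasure M2 X" if X: "X = {..<t} \<times> {..<s}" for X and t s :: real
  proof -
    \<comment> \<open>Clamping the corner to [0,1] turns the part of any quadrant inside the
      half-open square into a box covered by \<open>measure_box\<close>.\<close>
    define t' s' where "t' = max 0 (min 1 t)" and "s' = max 0 (min 1 s)"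
    have QX: "?Q \<inter> X = {0..<t'} \<times> {0..<s'}"
      unfolding X t'_def s'_def by auto
    have b: "0 \<le> t'" "t' \<le> 1" "0 \<le> s'" "s' \<le> 1" by (auto simp: t'_def s'_def)
    have Xb: "X \<in> sets borel" unfolding X by (intro borel_Times) auto
    have "emeasure M1 X = ennreal (c * t' * s')"
      unfolding M1[OF Xb] Int_assoc QX fin measure_box[OF b] ..
    also have "\<dots> = ennreal c * ennreal (t' * s')"
      using b c_bounds by (simp add: ennreal_mult mult.assoc)
    also have "ennreal (t' * s') = emeasure lborel ({0..<t'} \<times> {0..<s'})"
      using b by (simp add: emeasure_lborel_Times ennreal_mult)
    also have "ennreal c * \<dots> = emeasure M2 X"
      unfolding M2[OF Xb] QX ..
    finally show ?thesis .
  qed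
  have "M1 = M2"
  proof (rule measure_eqI_generator_eq[where \<Omega>=UNIV
        and E="range (\<lambda>a::real \<times> real. {x. eucl_less x a})" and A="\<lambda>n. {x. eucl_less x (real n, real n)}"])
    show "Int_stable (range (\<lambda>a::real \<times> real. {x. eucl_less x a}))"
    proof (rule Int_stableI)
      fix X Y assume "X \<in> range (\<lambda>a::real \<times> real. {x. eucl_less x a})"
        "Y \<in> range (\<lambda>a::real \<times> real. {x. eucl_less x a})"
      then obtain p q where X: "X = {x. eucl_less x p}" and Y: "Y = {x. eucl_less x q}"
        by blast
      have "X \<inter> Y = {x. eucl_less x (min (fst p) (fst q), min (snd p) (snd q))}"
        unfolding X Y using eucl_less_eq_Times[of "fst p" "snd p"] eucl_less_eq_Times[of "fst q" "snd q"]
        by (auto simp: eucl_less_eq_Times)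
      then show "X \<inter> Y \<in> range (\<lambda>a::real \<times> real. {x. eucl_less x a})" by blast
    qed
    show "emeasure M1 X = emeasure M2 X" if X: "X \<in> range (\<lambda>a::real \<times> real. {x. eucl_less x a})" for X
    proof -
      obtain p where p: "X = {x. eucl_less x p}" using X by blast
      show ?thesis
        by (rule eq) (use p eucl_less_eq_Times[of "fst p" "snd p"] in simp)
    qed
    have "sets borel = sigma_sets UNIV (range (\<lambda>a::real \<times> real. {x. eucl_less x a}))"
      by (subst borel_eq_lessThan) simp
    then show "sets M1 = sigma_sets UNIV (range (\<lambda>a::real \<times> real. {x. eucl_less x a}))"
      "sets M2 = sigma_sets UNIV (range (\<lambda>a::real \<times> real. {x. eucl_less x a}))"
      by (simp_all add: M1_def M2_def)
    show "(\<Union>n. {x::real \<times> real. eucl_less x (real n, real n)}) = UNIV"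
    proof (intro set_eqI iffI UNIV_I)
      fix p :: "real \<times> real"
      obtain x y where p: "p = (x, y)" by fastforce
      obtain n where "max x y < real n" using reals_Archimedean2 by blast
      then show "p \<in> (\<Union>n. {x. eucl_less x (real n, real n)})"
        unfolding p eucl_less_eq_Times by (intro UN_I[of n]) auto
    qed
    show "emeasure M1 {x. eucl_less x (real n, real n)} \<noteq> \<infinity>" for n
    proof -
      have "{x::real \<times> real. eucl_less x (real n, real n)} \<in> sets borel"
        unfolding eucl_less_eq_Times by (intro borel_Times) auto
      then show ?thesis
        using A_sub[of 0] emeasure_subset_square_finite[of "A 0 \<inter> ?Q \<inter> {x. eucl_less x (real n, real n)}"] M1
        by auto
    qed
  qed auto
  then have "emeasure M1 (A 0) = emeasure M2 (A 0)" by simp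
  moreover have "measure lborel (A 0 \<inter> ?Q) = c"
    using dev_1_0[of 0] by (simp add: dev_def J_def)
  ultimately have "ennreal c = ennreal c * ennreal c"
    using M1[OF A_borel] M2[OF A_borel] fin[of ?Q] by (simp add: Int_commute Int_left_commute)
  then have "c = c * c"
    using c_bounds by (simp add: ennreal_mult[symmetric])
  then show ?thesis by simp
qed

end

section \<open>Triviality of tail sets\<close>

context heterochaos
begin

text \<open>The set where \<open>B n\<close> and the preimage of \<open>B (Suc n)\<close> disagree
  is pulled back by \<open>f ^^ n\<close> into a null set, because both are tied to the same
  \<open>C\<close>; invariance of area then makes it null itself, as \<open>tail_sequence\<close>
  demands.\<close>

lemma tail_trivial:
  assumes C: "C \<in> sets borel" "C \<subseteq> unit_square"
    and B: "\<And>n. B n \<in> sets borel" "\<And>n. B n \<subseteq> unit_square"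
    and AE: "\<And>n. AE p in Leb_on unit_square. p \<in> C \<longleftrightarrow> (f ^^ n) p \<in> B n"
  shows "emeasure lborel C = 0 \<or> emeasure lborel C = 1"
proof -
  interpret tail_sequence m a B
  proof
    fix n
    let ?D = "sym_diff (B n) (f -` B (Suc n) \<inter> unit_square)"
    have D: "?D \<in> sets (Leb_on unit_square)"
      using B baker2_vimage_borel[OF B(1)[of "Suc n"]] by (auto simp: sets_Leb_on)
    have "emeasure (Leb_on unit_square) {p \<in> space (Leb_on unit_square). (f ^^ n) p \<in> ?D} = 0"
    proof (rule emeasure_eq_0_AE)
      show "AE p in Leb_on unit_square. \<not> (f ^^ n) p \<in> ?D"
        using AE[of n] AE[of "Suc n"] AE_space
      proof eventually_elim
        case (elim p)
        have "(f ^^ n) p \<in> unit_square"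
          using measurable_space[OF measure_preserving_iterate(1)[OF baker2_measure_preserving, of n]]
            elim by simp
        then show ?case using elim by auto
      qed
    qed
    moreover have "{p \<in> space (Leb_on unit_square). (f ^^ n) p \<in> ?D}
        = (f ^^ n) -` ?D \<inter> space (Leb_on unit_square)" by auto
    ultimately have "emeasure (Leb_on unit_square) ?D = 0"
      using measure_preserving_emeasure[OF baker2_measure_preserving D, of n] by simp
    then show "emeasure lborel ?D = 0"
      using B by (subst (asm) emeasure_Leb_on) auto
  qed (use B in auto)
  have "emeasure lborel C = emeasure lborel (B 0)"
  proof (rule emeasure_eq_AE)
    show "AE p in lborel. p \<in> C \<longleftrightarrow> p \<in> B 0"
      using AE[of 0] unfolding AE_Leb_on[OF unit_square_borel]
      by eventually_elim (use C B in auto)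
  qed (use C B in auto)
  moreover have "emeasure lborel (B 0) = ennreal c"
    unfolding c_def using emeasure_subset_square_finite[OF B(2)[of 0]] by (simp add: emeasure_eq_ennreal_measure)
  ultimately show ?thesis using zero_one by auto
qed

lemma exact_baker2: "exact (Leb_on unit_square) f"
  unfolding exact_def
proof (intro conjI baker2_measure_preserving)
  show "\<not> has_measurable_inverse (Leb_on unit_square) f"
  proof
    assume "has_measurable_inverse (Leb_on unit_square) f"
    then obtain S where S: "\<And>p. p \<in> unit_square \<Longrightarrow> S (f p) = p"
      by (auto simp: has_measurable_inverse_def)
    \<comment> \<open>Witness against injectivity: the lower right corners of the first two
      \<beta>-boxes both go to the corner \<open>(1, 0)\<close>.\<close>
    have *: "(1, 0) \<in> Omega_plus m a (Beta 1)" "(1, 1 / m) \<in> Omega_plus m a (Beta 2)"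
      "Beta 1 \<in> alphabet m" "Beta 2 \<in> alphabet m"
      using m_ge_2 m_a_le by (auto simp: alphabet_def divide_simps)
    then have "f (1, 0) = f (1, 1 / m)"
      using m_pos by (simp add: baker2_branch[OF *(3,1)] baker2_branch[OF *(4,2)] branch2_def)
    moreover have "(1, 0) \<in> unit_square" "(1, 1 / m) \<in> unit_square"
      using m_ge_2 by (auto simp: unit_square_def)
    ultimately have "(1, 0) = (1::real, 1 / real m)" using S by metis
    then show False using m_pos by simp
  qed
  show "eq_mod_null (Leb_on unit_square)
     (\<Inter>n. pullback_family (Leb_on unit_square) f n (sets (Leb_on unit_square)))
     {space (Leb_on unit_square), {}}"
  proof (rule eq_mod_null_trivial)
    fix C
    assume C: "C \<in> (\<Inter>n. pullback_family (Leb_on unit_square) f n (sets (Leb_on unit_square)))"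
    have "\<exists>B. B \<in> sets (Leb_on unit_square) \<and> C = (f ^^ n) -` B \<inter> unit_square" for n
    proof -
      have "C \<in> pullback_family (Leb_on unit_square) f n (sets (Leb_on unit_square))"
        using C by blast
      then show ?thesis unfolding pullback_family_def space_Leb_on by blast
    qed
    then obtain B where B: "\<And>n. B n \<in> sets (Leb_on unit_square)"
      "\<And>n. C = (f ^^ n) -` B n \<inter> unit_square" by metis
    have "C = B 0"
      using B(2)[of 0] sets.sets_into_space[OF B(1)[of 0]] by auto
    then have C: "C \<in> sets borel" "C \<subseteq> unit_square" using B(1)[of 0] by (auto simp: sets_Leb_on)
    have "AE p in Leb_on unit_square. p \<in> C \<longleftrightarrow> (f ^^ n) p \<in> B n" for n
      by (rule AE_I2) (use B(2)[of n] in auto)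
    then have "emeasure lborel C = 0 \<or> emeasure lborel C = 1"
      using B(1) C by (intro tail_trivial[where B=B]) (auto simp: sets_Leb_on)
    then show "C \<in> sets (Leb_on unit_square)"
      "emeasure (Leb_on unit_square) C = 0 \<or> emeasure (Leb_on unit_square) C = 1"
      using C by (simp_all add: sets_Leb_on emeasure_Leb_on)
  next
    fix E assume E: "E \<in> {space (Leb_on unit_square), {}}"
    have "E \<in> pullback_family (Leb_on unit_square) f n (sets (Leb_on unit_square))" for n
    proof -
      have "(f ^^ n) -` unit_square \<inter> unit_square = unit_square"
        using measurable_space[OF measure_preserving_iterate(1)[OF baker2_measure_preserving, of n]]
        by auto
      then have "E = (f ^^ n) -` E \<inter> unit_square" using E by auto
      moreover have "E \<in> sets (Leb_on unit_square)" using E by (auto simp: sets_Leb_on)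
      ultimately show ?thesis by (auto simp: pullback_family_def)
    qed
    then show "E \<in> (\<Inter>n. pullback_family (Leb_on unit_square) f n (sets (Leb_on unit_square)))"
      by blast
  qed (rule prob_space_Leb_on[OF unit_square_borel emeasure_unit_square])
qed

end

section \<open>The K-property\<close>

context heterochaos
begin

section \<open>The almost everywhere inverse of \<open>g\<close>\<close>

definition inv_branch :: "symb \<Rightarrow> (real \<times> real) \<times> real \<Rightarrow> (real \<times> real) \<times> real" where
  "inv_branch \<gamma> = (case \<gamma> of
     Alpha i \<Rightarrow> map_prod
       (map_prod (\<lambda>x. a * (x + (real i - 1))) (\<lambda>y. real m * (y - (real i - 1) / m)))
       (\<lambda>z. z / (real m * a))
   | Beta i \<Rightarrow> map_prod
       (map_prod (\<lambda>x. (1 - real m * a) * (x + real m * a / (1 - real m * a)))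
         (\<lambda>y. (y - (1 - real i)) / m))
       (\<lambda>z. (z - (1 - b * (real m + 1 - real i))) / b))"

lemma inv_branch_branch3: "inv_branch \<gamma> (branch3 \<gamma> q) = q" "branch3 \<gamma> (inv_branch \<gamma> q) = q"
proof -
  obtain x y z where q: "q = ((x, y), z)" by (metis surj_pair)
  have "1 - m * a \<noteq> 0" using m_a_le by linarith
  then show "inv_branch \<gamma> (branch3 \<gamma> q) = q" "branch3 \<gamma> (inv_branch \<gamma> q) = q"
    using a_pos m_pos b_pos
    by (auto simp: q inv_branch_def branch3_def branch2_def fibre_def split: symb.split)
qed

lemma inv_branch_borel: "inv_branch \<gamma> \<in> borel_measurable borel"
  by (cases \<gamma>) (auto simp: inv_branch_def intro!: map_prod_borel)

text \<open>The value off \<open>W\<close> is irrelevant; it only has to lie in the cube.\<close>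

definition S :: "(real \<times> real) \<times> real \<Rightarrow> (real \<times> real) \<times> real" where
  "S q = (if q \<in> W then inv_branch (THE \<gamma>. \<gamma> \<in> alphabet m \<and> q \<in> R \<gamma>) q else ((0, 0), 0))"

lemma S_eq:
  assumes "\<gamma> \<in> alphabet m" "q \<in> R \<gamma>"
  shows "S q = inv_branch \<gamma> q"
proof -
  have "(THE \<gamma>. \<gamma> \<in> alphabet m \<and> q \<in> R \<gamma>) = \<gamma>"
    using assms R_Rc_disjoint R_subset_Rc by blast
  then show ?thesis using assms by (auto simp: S_def W_def)
qed

lemma S_baker_g:
  assumes "q \<in> V"
  shows "g q \<in> W" "S (g q) = q"
proof -
  obtain \<gamma> where \<gamma>: "\<gamma> \<in> alphabet m" "q \<in> U \<gamma>" using assms by (auto simp: V_def)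
  have "q \<in> unit_cube" using assms W_V_subset_cube by auto
  then have R: "g q \<in> R \<gamma>" using baker_g_in_R \<gamma> by blast
  then show "g q \<in> W" using \<gamma> by (auto simp: W_def)
  have "g q = branch3 \<gamma> q" using baker_g_branch \<gamma> U_subset_Omega by blast
  then show "S (g q) = q" using S_eq[OF \<gamma>(1) R] inv_branch_branch3 by simp
qed

lemma baker_g_S:
  assumes "q \<in> W"
  shows "S q \<in> V" "g (S q) = q"
proof -
  obtain \<gamma> where \<gamma>: "\<gamma> \<in> alphabet m" "q \<in> R \<gamma>" using assms by (auto simp: W_def)
  then have "branch3 \<gamma> (S q) = q" using S_eq inv_branch_branch3 by simp
  then have U: "S q \<in> U \<gamma>" using branch3_in_R_iff \<gamma> by metis
  then show "S q \<in> V" using \<gamma> by (auto simp: V_def)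
  show "g (S q) = q"
    using baker_g_branch[OF \<gamma>(1), of "S q"] U U_subset_Omega[OF \<gamma>(1)] \<open>branch3 \<gamma> (S q) = q\<close>
    by auto
qed

text \<open>Boundary points never land in an open image box. Hence a backward orbit in the cube that
  ends in \<open>W\<close> had its last step in \<open>V\<close>, where \<open>S\<close> undoes
  \<open>g\<close>.\<close>

lemma baker_g_in_W:
  assumes "q \<in> unit_cube" "g q \<in> W"
  shows "q \<in> V"
  using assms baker_g_in_R by (auto simp: W_def V_def)

lemma S_cube: "S q \<in> unit_cube"
proof (cases "q \<in> W")
  case True
  then show ?thesis using baker_g_S(1) W_V_subset_cube by blast
qed (simp add: S_def unit_cube_def unit_square_def)

lemma S_measurable: "S \<in> measurable (Leb_on unit_cube) (Leb_on unit_cube)"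
proof (rule measurable_Leb_onI)
  fix B :: "((real \<times> real) \<times> real) set" assume B: "B \<in> sets borel"
  have "S -` B \<inter> unit_cube = (\<Union>\<gamma>\<in>alphabet m. inv_branch \<gamma> -` B \<inter> R \<gamma>) \<union>
      (if ((0, 0), 0) \<in> B then unit_cube - W else {})"
  proof (rule set_eqI)
    fix q
    show "q \<in> S -` B \<inter> unit_cube \<longleftrightarrow> q \<in> (\<Union>\<gamma>\<in>alphabet m. inv_branch \<gamma> -` B \<inter> R \<gamma>) \<union>
      (if ((0, 0), 0) \<in> B then unit_cube - W else {})"
    proof (cases "q \<in> W")
      case True
      then obtain \<gamma> where \<gamma>: "\<gamma> \<in> alphabet m" "q \<in> R \<gamma>" by (auto simp: W_def)
      have "q \<in> (\<Union>\<gamma>\<in>alphabet m. inv_branch \<gamma> -` B \<inter> R \<gamma>) \<longleftrightarrow> S q \<in> B"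
        using \<gamma> S_eq[of _ q, symmetric] by (auto intro!: bexI[of _ \<gamma>])
      then show ?thesis using True W_V_subset_cube by auto
    next
      case False
      then show ?thesis by (auto simp: S_def W_def)
    qed
  qed
  moreover have "inv_branch \<gamma> -` B \<in> sets borel" for \<gamma>
    using measurable_sets[OF inv_branch_borel B] by simp
  ultimately show "S -` B \<inter> unit_cube \<in> sets borel"
    using finite_alphabet by (auto intro!: sets.Un sets.finite_UN)
qed (use S_cube in auto)

lemma AE_cube_V: "AE q in Leb_on unit_cube. q \<in> V"
  and AE_cube_W: "AE q in Leb_on unit_cube. q \<in> W"
  using AE_cube_W_V unfolding AE_Leb_on[OF unit_cube_borel] by (eventually_elim; auto)+

text \<open>Volume equals its own pushforward under \<open>g\<close>, and \<open>S \<circ> g\<close>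
  is the identity almost everywhere, so pushing forward by \<open>S\<close> gives volume
  back.\<close>

lemma S_measure_preserving: "measure_preserving_system (Leb_on unit_cube) S"
proof -
  let ?M = "Leb_on unit_cube"
  have g: "g \<in> measurable ?M ?M" "distr ?M ?M g = ?M" "prob_space ?M"
    using baker_g_measure_preserving by (auto simp: measure_preserving_system_def)
  have "distr ?M ?M S = distr (distr ?M ?M g) ?M S" using g by simp
  also have "\<dots> = distr ?M ?M (S \<circ> g)" using g S_measurable by (intro distr_distr)
  also have "\<dots> = distr ?M ?M (\<lambda>q. q)"
  proof (rule distr_cong_AE)
    show "AE q in ?M. (S \<circ> g) q = q"
      using AE_cube_V by eventually_elim (simp add: S_baker_g)
  qed (use g S_measurable in \<open>auto intro: measurable_comp\<close>)
  also have "\<dots> = ?M" by (simp add: distr_id)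
  finally show ?thesis
    using g S_measurable by (simp add: measure_preserving_system_def)
qed

section \<open>The invariant set \<open>Lambda\<close>\<close>

abbreviation L :: "((real \<times> real) \<times> real) set" where
  "L \<equiv> Lambda m a (1 / real m - a)"

text \<open>The definition uses forward images, for which neither measurability nor full measure is
  immediate. Uniqueness of preimages of points of \<open>W\<close> turns them into conditions on the
  backward orbit under \<open>S\<close>, hence into preimages under a measurable map.\<close>

lemma Lambda_iff: "q \<in> L \<longleftrightarrow> q \<in> unit_cube \<and> (\<forall>n. (g ^^ n) q \<in> V \<and> (S ^^ n) q \<in> W)"
proof -
  have V: "(\<Union>\<gamma>\<in>alphabet m. interior (Omega m a \<gamma>)) = V"
    by (simp add: V_def interior_Omega)
  have g: "baker3 m a (1 / real m - a) = g" by (simp add: baker_g_def)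
  have iter_cube: "(g ^^ n) q \<in> unit_cube" if "q \<in> unit_cube" for q n
    by (induction n) (use that baker_g_cube in auto)
  have L: "q \<in> L \<longleftrightarrow> q \<in> unit_cube \<and> (\<forall>n. (g ^^ n) q \<in> V \<and> q \<in> (g ^^ n) ` V)" for q
  proof
    assume "q \<in> L"
    then have *: "q \<in> int_preimage unit_cube g n V" for n
      by (auto simp: Lambda_def V g)
    have "(g ^^ n) q \<in> V \<and> q \<in> unit_cube" for n
      using *[of "int n"] by (simp add: int_preimage_def)
    moreover have "q \<in> (g ^^ n) ` V" for n
    proof (cases "n = 0")
      case True
      then show ?thesis using calculation[of 0] by simp
    next
      case False
      then have "int_preimage unit_cube g (- int n) V = (g ^^ n) ` V"
        by (simp add: int_preimage_def)
      then show ?thesis using *[of "- int n"] by simp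
    qed
    ultimately show "q \<in> unit_cube \<and> (\<forall>n. (g ^^ n) q \<in> V \<and> q \<in> (g ^^ n) ` V)" by blast
  next
    assume "q \<in> unit_cube \<and> (\<forall>n. (g ^^ n) q \<in> V \<and> q \<in> (g ^^ n) ` V)"
    then have "q \<in> int_preimage unit_cube g n V" for n
      by (cases "n \<ge> 0") (auto simp: int_preimage_def)
    then show "q \<in> L" unfolding Lambda_def V g by blast
  qed
  show ?thesis
  proof
    have W: "q \<in> W" if "q \<in> L" for q
    proof -
      have "q \<in> (g ^^ 1) ` V" using that L by blast
      then show ?thesis using S_baker_g by auto
    qed
    have S: "S q \<in> L" if q: "q \<in> L" for q
      unfolding L
    proof (intro conjI allI S_cube)
      fix n
      show "(g ^^ n) (S q) \<in> V"
      proof (cases n)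
        case (Suc k)
        have "(g ^^ n) (S q) = (g ^^ k) q"
          using baker_g_S[OF W[OF q]] Suc by (simp add: funpow_Suc_right del: funpow.simps(2))
        then show ?thesis using q L by simp
      qed (use baker_g_S[OF W[OF q]] in simp)
      \<comment> \<open>Asking for one image more makes \<open>(g ^^ n) u\<close> a preimage of
        \<open>q\<close>. It lies in the cube and is sent into \<open>W\<close>, so it is in
        \<open>V\<close> and equals \<open>S q\<close>.\<close>
      have "q \<in> (g ^^ Suc n) ` V" using q L by blast
      then obtain u where u: "u \<in> V" "q = g ((g ^^ n) u)" by auto
      have "(g ^^ n) u \<in> unit_cube" using u W_V_subset_cube(2) iter_cube by blast
      then have "(g ^^ n) u \<in> V" using baker_g_in_W W[OF q] u by auto
      then have "S q = (g ^^ n) u" using u S_baker_g by auto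
      then show "S q \<in> (g ^^ n) ` V" using u by auto
    qed
    assume q: "q \<in> L"
    have "(S ^^ n) q \<in> L" for n
      by (induction n) (use q S in auto)
    then show "q \<in> unit_cube \<and> (\<forall>n. (g ^^ n) q \<in> V \<and> (S ^^ n) q \<in> W)"
      using q L W by blast
  next
    assume q: "q \<in> unit_cube \<and> (\<forall>n. (g ^^ n) q \<in> V \<and> (S ^^ n) q \<in> W)"
    have V: "(S ^^ n) q \<in> V" for n
    proof (cases n)
      case 0
      then show ?thesis using q[THEN conjunct2, rule_format, of 0] by simp
    next
      case (Suc k)
      then show ?thesis using q baker_g_S by simp
    qed
    have "(g ^^ n) ((S ^^ n) q) = q" for n
    proof (induction n)
      case (Suc n)
      have "(g ^^ Suc n) ((S ^^ Suc n) q) = (g ^^ n) (g (S ((S ^^ n) q)))"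
        by (simp add: funpow_swap1)
      also have "\<dots> = (g ^^ n) ((S ^^ n) q)" using q baker_g_S by simp
      finally show ?case using Suc by simp
    qed simp
    then have "q \<in> (g ^^ n) ` V" for n using V by (metis imageI)
    then show "q \<in> L" using q L by blast
  qed
qed

lemma L_subset_cube: "L \<subseteq> unit_cube"
  using Lambda_iff by blast

lemma L_borel: "L \<in> sets borel"
proof -
  let ?M = "Leb_on unit_cube"
  have sets: "V \<in> sets ?M" "W \<in> sets ?M" using W_V_subset_cube by (auto simp: sets_Leb_on)
  have eq: "L = (\<Inter>n. (g ^^ n) -` V \<inter> space ?M) \<inter> (\<Inter>n. (S ^^ n) -` W \<inter> space ?M)"
    using Lambda_iff by auto
  have "L \<in> sets ?M"
    unfolding eq
    using measurable_sets[OF measure_preserving_iterate(1)[OF baker_g_measure_preserving] sets(1)]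
      measurable_sets[OF measure_preserving_iterate(1)[OF S_measure_preserving] sets(2)]
    by (intro sets.Int sets.countable_INT) blast+
  then show ?thesis by (simp add: sets_Leb_on)
qed

text \<open>Each of the countably many conditions in \<open>Lambda_iff\<close> holds almost
  everywhere at time 0, and invariance under \<open>g\<close> and \<open>S\<close> carries it to
  time \<open>n\<close>.\<close>

lemma AE_L: "AE q in lborel. q \<in> unit_cube \<longrightarrow> q \<in> L"
proof -
  have "AE q in Leb_on unit_cube. q \<in> L"
    using measure_preserving_AE_iterate[OF baker_g_measure_preserving AE_cube_V]
      measure_preserving_AE_iterate[OF S_measure_preserving AE_cube_W] AE_space
    by eventually_elim (auto simp: Lambda_iff)
  then show ?thesis unfolding AE_Leb_on[OF unit_cube_borel] .
qed

lemma emeasure_Int_L: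
  assumes "X \<in> sets borel" "X \<subseteq> unit_cube"
  shows "emeasure lborel (X \<inter> L) = emeasure lborel X"
proof (rule emeasure_eq_AE)
  show "AE q in lborel. q \<in> X \<inter> L \<longleftrightarrow> q \<in> X"
    using AE_L by eventually_elim (use assms in auto)
qed (use assms L_borel in auto)

lemma emeasure_L: "emeasure lborel L = 1"
  using emeasure_Int_L[OF unit_cube_borel] emeasure_unit_cube L_subset_cube
  by (simp add: Int_absorb1)

text \<open>\<open>has_measurable_inverse\<close> asks for an inverse at every point; restricting
  from the cube to \<open>L\<close> turns the almost everywhere inverse \<open>S\<close> into
  one.\<close>

lemma L_invariant:
  assumes q: "q \<in> L"
  shows "g q \<in> L" "S q \<in> L" "S (g q) = q" "g (S q) = q"
proof -
  have V: "(g ^^ n) q \<in> V" and W: "(S ^^ n) q \<in> W" and cube: "q \<in> unit_cube" for n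
    using q Lambda_iff by auto
  show Sg: "S (g q) = q" using S_baker_g V[of 0] by simp
  show gS: "g (S q) = q" using baker_g_S W[of 0] by simp
  show "g q \<in> L"
    unfolding Lambda_iff
  proof (intro conjI allI)
    show "g q \<in> unit_cube" using cube by (rule baker_g_cube)
    fix n
    show "(g ^^ n) (g q) \<in> V" using V[of "Suc n"] by (simp add: funpow_swap1)
    show "(S ^^ n) (g q) \<in> W"
    proof (cases n)
      case (Suc k)
      have "(S ^^ n) (g q) = (S ^^ k) q"
        using Sg Suc by (simp add: funpow_Suc_right del: funpow.simps(2))
      then show ?thesis using W by simp
    qed (use S_baker_g V[of 0] in simp)
  qed
  show "S q \<in> L"
    unfolding Lambda_iff
  proof (intro conjI allI S_cube)
    fix n
    show "(S ^^ n) (S q) \<in> W" using W[of "Suc n"] by (simp add: funpow_swap1)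
    show "(g ^^ n) (S q) \<in> V"
    proof (cases n)
      case (Suc k)
      have "(g ^^ n) (S q) = (g ^^ k) q"
        using gS Suc by (simp add: funpow_Suc_right del: funpow.simps(2))
      then show ?thesis using V by simp
    qed (use baker_g_S W[of 0] in simp)
  qed
qed

lemma L_iterates:
  assumes q: "q \<in> L"
  shows "(g ^^ n) q \<in> L" "(S ^^ n) q \<in> L" "(S ^^ n) ((g ^^ n) q) = q" "(g ^^ n) ((S ^^ n) q) = q"
proof -
  have g: "(g ^^ n) q \<in> L" and S: "(S ^^ n) q \<in> L" for n
    by (induction n) (use q L_invariant in auto)
  then show "(g ^^ n) q \<in> L" "(S ^^ n) q \<in> L" by auto
  show "(S ^^ n) ((g ^^ n) q) = q"
  proof (induction n)
    case (Suc n)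
    have "(S ^^ Suc n) ((g ^^ Suc n) q) = (S ^^ n) (S (g ((g ^^ n) q)))"
      by (simp add: funpow_swap1)
    then show ?case using Suc L_invariant g by simp
  qed simp
  show "(g ^^ n) ((S ^^ n) q) = q"
  proof (induction n)
    case (Suc n)
    have "(g ^^ Suc n) ((S ^^ Suc n) q) = (g ^^ n) (g (S ((S ^^ n) q)))"
      by (simp add: funpow_swap1)
    then show ?case using Suc L_invariant S by simp
  qed simp
qed

lemma measurable_restrict_L:
  assumes "T \<in> measurable (Leb_on unit_cube) (Leb_on unit_cube)" "\<And>q. q \<in> L \<Longrightarrow> T q \<in> L"
  shows "T \<in> measurable (Leb_on L) (Leb_on L)"
proof (rule measurable_Leb_onI[OF L_borel assms(2)])
  fix B :: "((real \<times> real) \<times> real) set" assume B: "B \<in> sets borel"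
  have "T -` B \<inter> L = T -` B \<inter> unit_cube \<inter> L" using L_subset_cube by auto
  then show "T -` B \<inter> L \<in> sets borel"
    using measurable_Leb_onD[OF unit_cube_borel assms(1) B] L_borel by simp
qed

lemma baker_g_L_measurable: "g \<in> measurable (Leb_on L) (Leb_on L)"
  and S_L_measurable: "S ^^ n \<in> measurable (Leb_on L) (Leb_on L)"
  using baker_g_measure_preserving L_invariant L_iterates
    measure_preserving_iterate(1)[OF S_measure_preserving]
  by (auto intro!: measurable_restrict_L simp: measure_preserving_system_def)

lemma baker_g_L_measure_preserving: "measure_preserving_system (Leb_on L) g"
proof -
  have "distr (Leb_on L) (Leb_on L) g = Leb_on L"
  proof (rule measure_eqI)
    fix B assume "B \<in> sets (distr (Leb_on L) (Leb_on L) g)"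
    then have B: "B \<in> sets borel" "B \<subseteq> L" by (auto simp: sets_Leb_on L_borel)
    have "emeasure (distr (Leb_on L) (Leb_on L) g) B = emeasure lborel (g -` B \<inter> L)"
      using B baker_g_L_measurable
      by (simp add: emeasure_distr sets_Leb_on L_borel emeasure_Leb_on)
    also have "g -` B \<inter> L = g -` B \<inter> unit_cube \<inter> L" using L_subset_cube by auto
    also have "emeasure lborel \<dots> = emeasure lborel (g -` B \<inter> unit_cube)"
      using B by (intro emeasure_Int_L baker_g_vimage_borel) auto
    also have "\<dots> = emeasure lborel B"
      using B L_subset_cube by (intro emeasure_baker_g_vimage) auto
    finally show "emeasure (distr (Leb_on L) (Leb_on L) g) B = emeasure (Leb_on L) B"
      using B by (simp add: emeasure_Leb_on L_borel)
  qed simp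
  then show ?thesis
    using baker_g_L_measurable prob_space_Leb_on[OF L_borel emeasure_L]
    by (simp add: measure_preserving_system_def)
qed

section \<open>Fibre contraction and the projected sigma-algebra\<close>

lemma iterate_fst: "fst ((g ^^ n) q) = (f ^^ n) (fst q)"
  by (induction n) (auto simp: baker_g_fst)

text \<open>Points over the same base point keep the same symbols for ever, so each step multiplies
  their distance by \<open>m * a\<close> or \<open>b\<close>. Both are at most 1/2, the second
  because \<open>2 * b \<le> m * b = 1 - m * a\<close>.\<close>

lemma iterate_snd_contracts:
  assumes "p \<in> unit_square" "z \<in> {0..1}" "z' \<in> {0..1}"
  shows "\<bar>snd ((g ^^ n) (p, z)) - snd ((g ^^ n) (p, z'))\<bar> \<le> (1 / 2) ^ n"
proof (induction n)
  case 0
  then show ?case using assms by auto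
next
  case (Suc n)
  have cube: "(p, z) \<in> unit_cube" "(p, z') \<in> unit_cube" using assms by (auto simp: unit_cube_def)
  then have "(g ^^ n) (p, z) \<in> unit_cube" "(g ^^ n) (p, z') \<in> unit_cube" for n
    by (induction n) (auto simp: baker_g_cube)
  note it = this[of n]
  obtain u w where u: "(g ^^ n) (p, z) = (u, w)" by fastforce
  obtain u' w' where u': "(g ^^ n) (p, z') = (u', w')" by fastforce
  have "u = u'" using iterate_fst[of n "(p, z)"] iterate_fst[of n "(p, z')"] u u' by simp
  obtain \<gamma> where \<gamma>: "\<gamma> \<in> alphabet m" "(u, w) \<in> Omega m a \<gamma>"
    using Omega_cover it(1) u by metis
  then have "(u, w') \<in> Omega m a \<gamma>"
    using it(2) u' \<open>u = u'\<close> by (auto simp: Omega_def unit_cube_def)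
  then have "snd (g (u, w)) - snd (g (u, w')) = fibre \<gamma> w - fibre \<gamma> w'"
    using \<gamma> baker_g_branch by (simp add: branch3_def)
  also have "\<dots> = (case \<gamma> of Alpha i \<Rightarrow> m * a | Beta i \<Rightarrow> b) * (w - w')"
    by (simp add: fibre_def algebra_simps split: symb.split)
  finally have "\<bar>snd (g (u, w)) - snd (g (u, w'))\<bar>
      = \<bar>case \<gamma> of Alpha i \<Rightarrow> m * a | Beta i \<Rightarrow> b\<bar> * \<bar>w - w'\<bar>"
    by (simp add: abs_mult)
  also have "\<dots> \<le> 1 / 2 * (1 / 2) ^ n"
  proof (rule mult_mono)
    have "2 * b \<le> m * b" using m_ge_2 b_pos by (intro mult_right_mono) auto
    then have "b \<le> 1 / 2" using m_b m_a_pos by linarith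
    then show "\<bar>case \<gamma> of Alpha i \<Rightarrow> m * a | Beta i \<Rightarrow> b\<bar> \<le> 1 / 2"
      using b_pos m_a_le a_pos by (auto split: symb.split)
    show "\<bar>w - w'\<bar> \<le> (1 / 2) ^ n" using Suc u u' by simp
  qed auto
  finally show ?case using u u' \<open>u = u'\<close> by simp
qed

definition past :: "((real \<times> real) \<times> real) set set" where
  "past = {fst -` A \<inter> L | A. A \<in> sets borel}"

lemma fst_vimage_borel:
  assumes "A \<in> sets borel"
  shows "(fst -` A :: ((real \<times> real) \<times> real) set) \<in> sets borel"
proof -
  have "(fst :: (real \<times> real) \<times> real \<Rightarrow> _) \<in> borel_measurable borel"
    by (intro borel_measurable_continuous_onI continuous_on_fst continuous_on_id)
  from measurable_sets[OF this assms] show ?thesis by simp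
qed

lemma past_sub_sigma_algebra: "sub_sigma_algebra (Leb_on L) past"
proof -
  have "sets (vimage_algebra L fst borel) = past"
    unfolding past_def by (rule sets_vimage_algebra2) simp
  then have "sigma_algebra L past"
    using sets.sigma_algebra_axioms[of "vimage_algebra L fst borel"] by simp
  moreover have "past \<subseteq> sets (Leb_on L)"
    using fst_vimage_borel L_borel by (auto simp: past_def sets_Leb_on)
  ultimately show ?thesis by (simp add: sub_sigma_algebra_def)
qed

text \<open>The base of \<open>g q\<close> is a function of the base of \<open>q\<close> alone. As
  \<open>g\<close> is a bijection of \<open>L\<close>, this is the inclusion of \<open>past\<close>
  in its image under \<open>g\<close>, read backwards.\<close>

lemma past_vimage:
  assumes "K \<in> past"
  shows "g -` K \<inter> L \<in> past"
proof -
  obtain A where A: "A \<in> sets borel" "K = fst -` A \<inter> L" using assms by (auto simp: past_def)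
  have "fst q \<in> unit_square" if "q \<in> L" for q
    using that L_subset_cube by (auto simp: unit_cube_def)
  then have "g -` K \<inter> L = fst -` (f -` A \<inter> unit_square) \<inter> L"
    unfolding A using L_invariant(1) by (intro set_eqI) (simp add: baker_g_fst, blast)
  then show ?thesis using baker2_vimage_borel[OF A(1)] unfolding past_def by blast
qed

lemma iterate_image_L:
  assumes "B \<subseteq> L"
  shows "(g ^^ n) ` B = (S ^^ n) -` B \<inter> L"
proof
  show "(g ^^ n) ` B \<subseteq> (S ^^ n) -` B \<inter> L" using assms L_iterates by auto
  show "(S ^^ n) -` B \<inter> L \<subseteq> (g ^^ n) ` B"
  proof
    fix q assume "q \<in> (S ^^ n) -` B \<inter> L"
    then have "q = (g ^^ n) ((S ^^ n) q)" "(S ^^ n) q \<in> B" using L_iterates by auto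
    then show "q \<in> (g ^^ n) ` B" by blast
  qed
qed

lemma past_pushforward: "past \<subseteq> pushforward_family g 1 past"
proof
  fix K assume K: "K \<in> past"
  have "K = (g ^^ 1) ` (g -` K \<inter> L)"
  proof
    show "K \<subseteq> (g ^^ 1) ` (g -` K \<inter> L)"
    proof
      fix q assume "q \<in> K"
      moreover from this K have "q \<in> L" by (auto simp: past_def)
      ultimately have "q = g (S q)" "S q \<in> g -` K \<inter> L" using L_invariant by auto
      then show "q \<in> (g ^^ 1) ` (g -` K \<inter> L)" by auto
    qed
  qed auto
  then show "K \<in> pushforward_family g 1 past"
    using past_vimage[OF K] unfolding pushforward_family_def by blast
qed

text \<open>\<open>g\<close> contracts the fibres over the square, so \<open>z\<close> is a limit of functions of the projected past.\<close>

lemma past_generates: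
  "sigma_sets L (\<Union>n. pushforward_family g n past) = sets (Leb_on L)"
proof
  have push: "pushforward_family g n past \<subseteq> sets (Leb_on L)" for n
  proof
    fix B assume "B \<in> pushforward_family g n past"
    then obtain K where K: "K \<in> past" "B = (g ^^ n) ` K" by (auto simp: pushforward_family_def)
    have "K \<in> sets (Leb_on L)" using K past_sub_sigma_algebra by (auto simp: sub_sigma_algebra_def)
    moreover have "B = (S ^^ n) -` K \<inter> L"
      unfolding K by (rule iterate_image_L) (use K in \<open>auto simp: past_def\<close>)
    ultimately show "B \<in> sets (Leb_on L)" using measurable_sets[OF S_L_measurable, of K n] by simp
  qed
  then show "sigma_sets L (\<Union>n. pushforward_family g n past) \<subseteq> sets (Leb_on L)"
    using sets.sigma_sets_subset[of "\<Union>n. pushforward_family g n past" "Leb_on L"] by auto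
  define P where "P = sigma L (\<Union>n. pushforward_family g n past)"
  have sub: "(\<Union>n. pushforward_family g n past) \<subseteq> Pow L"
    using push sets.space_closed[of "Leb_on L"] by fastforce
  have P: "space P = L" "sets P = sigma_sets L (\<Union>n. pushforward_family g n past)"
    using sub by (simp_all add: P_def)
  have in_P: "(S ^^ n) -` (fst -` A) \<inter> L \<in> sets P" if "A \<in> sets borel" for A n
  proof -
    have "(S ^^ n) -` (fst -` A) \<inter> L = (g ^^ n) ` (fst -` A \<inter> L)"
      unfolding iterate_image_L[OF Int_lower2] using L_iterates(2)[of _ n] by blast
    moreover have "fst -` A \<inter> L \<in> past" using that by (auto simp: past_def)
    ultimately show ?thesis unfolding P by (auto simp: pushforward_family_def)
  qed
  have fst: "fst \<in> borel_measurable P"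
    by (rule measurableI) (use in_P[of _ 0] P in auto)
  have "snd \<in> borel_measurable P"
  proof (rule borel_measurable_LIMSEQ_real)
    \<comment> \<open>Take the base point \<open>n\<close> steps ago, restart at height 0 and run
      forward \<open>n\<close> steps. The result depends on \<open>q\<close> only through
      \<open>fst ((S ^^ n) q)\<close>, which is measurable for the \<open>n\<close>-th pushforward,
      and contraction puts it within \<open>(1 / 2) ^ n\<close> of \<open>snd q\<close>.\<close>
    define \<psi> where "\<psi> n q = snd ((g ^^ n) (fst ((S ^^ n) q), 0))" for n q
    show "(\<lambda>n. \<psi> n q) \<longlonglongrightarrow> snd q" if "q \<in> space P" for q
    proof -
      have q: "q \<in> L" using that P by simp
      have bound: "\<bar>\<psi> n q - snd q\<bar> \<le> (1 / 2) ^ n" for n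
      proof -
        obtain p z where pz: "(S ^^ n) q = (p, z)" by fastforce
        have "(p, z) \<in> unit_cube" using L_iterates(2)[OF q, of n] pz L_subset_cube by auto
        then have "\<bar>snd ((g ^^ n) (p, 0)) - snd ((g ^^ n) (p, z))\<bar> \<le> (1 / 2) ^ n"
          by (intro iterate_snd_contracts) (auto simp: unit_cube_def)
        then show ?thesis using L_iterates(4)[OF q, of n] pz by (simp add: \<psi>_def)
      qed
      have "(\<lambda>n. \<psi> n q - snd q) \<longlonglongrightarrow> 0"
      proof (rule Lim_null_comparison)
        show "\<forall>\<^sub>F n in sequentially. norm (\<psi> n q - snd q) \<le> (1 / 2) ^ n"
          using bound by (intro always_eventually allI) (simp only: real_norm_def)
        show "(\<lambda>n. (1 / 2 :: real) ^ n) \<longlonglongrightarrow> 0" by (rule LIMSEQ_power_zero) simp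
      qed
      then show ?thesis by (rule LIM_zero_cancel)
    qed
    show "\<psi> n \<in> borel_measurable P" for n
    proof (rule measurableI)
      fix B :: "real set" assume B: "B \<in> sets borel"
      define A where "A = (\<lambda>p. (p, 0)) -` ((g ^^ n) -` (snd -` B) \<inter> unit_cube)"
      have "(snd :: (real \<times> real) \<times> real \<Rightarrow> _) \<in> borel_measurable borel"
        by (intro borel_measurable_continuous_onI continuous_on_snd continuous_on_id)
      from measurable_sets[OF this B] have "(g ^^ n) -` (snd -` B) \<inter> unit_cube \<in> sets borel"
        using measurable_Leb_onD[OF unit_cube_borel
            measure_preserving_iterate(1)[OF baker_g_measure_preserving, of n]] by simp
      moreover have "(\<lambda>p::real \<times> real. (p, 0::real)) \<in> borel_measurable borel"
        by (intro borel_measurable_continuous_onI continuous_intros)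
      ultimately have A: "A \<in> sets borel"
        unfolding A_def
        using measurable_sets[of "\<lambda>p::real \<times> real. (p, 0::real)" borel borel]
        by (simp del: vimage_Int)
      have "\<psi> n -` B \<inter> L = (S ^^ n) -` (fst -` A) \<inter> L"
      proof (intro set_eqI)
        fix q
        have "(fst ((S ^^ n) q), 0) \<in> unit_cube" if "q \<in> L"
          using L_iterates(2)[OF that, of n] L_subset_cube by (auto simp: unit_cube_def)
        then show "q \<in> \<psi> n -` B \<inter> L \<longleftrightarrow> q \<in> (S ^^ n) -` (fst -` A) \<inter> L"
          by (auto simp: A_def \<psi>_def)
      qed
      then show "\<psi> n -` B \<inter> space P \<in> sets P" using in_P[OF A] P by simp
    qed simp
  qed
  with fst have "(\<lambda>q. (fst q, snd q)) \<in> measurable P (borel \<Otimes>\<^sub>M borel)"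
    by (rule measurable_Pair)
  then have id: "(\<lambda>q. q) \<in> measurable P borel"
    by (simp add: borel_prod)
  show "sets (Leb_on L) \<subseteq> sigma_sets L (\<Union>n. pushforward_family g n past)"
  proof
    fix B assume "B \<in> sets (Leb_on L)"
    then have B: "B \<in> sets borel" "B \<subseteq> L" by (auto simp: sets_Leb_on L_borel)
    then have "(\<lambda>q. q) -` B \<inter> space P = B" using P by auto
    then show "B \<in> sigma_sets L (\<Union>n. pushforward_family g n past)"
      using measurable_sets[OF id B(1)] P by simp
  qed
qed

text \<open>A tail set of \<open>past\<close> is the part of a column
  \<open>B 0 \<times> {0..1}\<close> inside \<open>L\<close>. Its defining equations hold only at
  base points of \<open>L\<close>, that is almost everywhere in the square, which is all that
  \<open>tail_trivial\<close> asks for.\<close>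

lemma past_tail_trivial:
  "eq_mod_null (Leb_on L) (\<Inter>n. pullback_family (Leb_on L) g n past) {space (Leb_on L), {}}"
proof (rule eq_mod_null_trivial)
  show "prob_space (Leb_on L)" by (rule prob_space_Leb_on[OF L_borel emeasure_L])
next
  fix K assume K: "K \<in> (\<Inter>n. pullback_family (Leb_on L) g n past)"
  have "\<exists>A. A \<in> sets borel \<and> K = (g ^^ n) -` (fst -` A \<inter> L) \<inter> L" for n
  proof -
    have "K \<in> pullback_family (Leb_on L) g n past" using K by blast
    then show ?thesis unfolding pullback_family_def past_def space_Leb_on by blast
  qed
  then obtain A where A: "\<And>n. A n \<in> sets borel" "\<And>n. K = (g ^^ n) -` (fst -` A n \<inter> L) \<inter> L"
    by metis
  define B where "B n = A n \<inter> unit_square" for n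
  have B: "B n \<in> sets borel" "B n \<subseteq> unit_square" for n using A by (auto simp: B_def)
  have K_iff: "q \<in> K \<longleftrightarrow> (f ^^ n) (fst q) \<in> B n" if q: "q \<in> L" for n q
  proof -
    have "fst ((g ^^ n) q) \<in> unit_square"
      using L_iterates(1)[OF q, of n] L_subset_cube by (auto simp: unit_cube_def)
    then show ?thesis
      using q A(2)[of n] L_iterates(1)[OF q, of n] by (auto simp: B_def iterate_fst)
  qed
  have AE: "AE p in Leb_on unit_square. p \<in> B 0 \<longleftrightarrow> (f ^^ n) p \<in> B n" for n
  proof -
    \<comment> \<open>Over \<open>D\<close> the two descriptions of \<open>K\<close> contradict each
      other, so the whole column over \<open>D\<close> misses \<open>L\<close>. As \<open>L\<close>
      has full measure, the column and hence \<open>D\<close> are null.\<close>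
    define D where "D = sym_diff (B 0) ((f ^^ n) -` B n \<inter> unit_square)"
    have "(f ^^ n) -` B n \<inter> unit_square \<in> sets borel"
      using measurable_Leb_onD[OF unit_square_borel
          measure_preserving_iterate(1)[OF baker2_measure_preserving]] B by blast
    then have D: "D \<in> sets borel" "D \<subseteq> unit_square" using B by (auto simp: D_def)
    have "emeasure lborel (D \<times> {0..1::real}) = emeasure lborel (D \<times> {0..1::real} \<inter> L)"
      using D by (intro emeasure_Int_L[symmetric] borel_Times) (auto simp: unit_cube_def)
    also have "D \<times> {0..1} \<inter> L = {}"
    proof -
      have "q \<notin> L" if "q \<in> D \<times> {0..1}" for q
        using that K_iff[of q 0] K_iff[of q n] B(2)[of 0] by (auto simp: D_def)
      then show ?thesis by blast
    qed
    finally have "emeasure lborel D = 0"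
      using D by (simp add: emeasure_lborel_Times)
    then have "AE p in lborel. p \<notin> D" using D by (intro AE_not_in null_setsI) auto
    then show ?thesis unfolding AE_Leb_on[OF unit_square_borel]
      by eventually_elim (auto simp: D_def)
  qed
  have "emeasure lborel (B 0) = 0 \<or> emeasure lborel (B 0) = 1"
    using B AE by (intro tail_trivial[where B=B]) auto
  moreover have K_eq: "K = B 0 \<times> {0..1} \<inter> L"
  proof (rule set_eqI)
    fix q
    have "K \<subseteq> L" using A(2)[of 0] by auto
    moreover have "snd q \<in> {0..1}" if "q \<in> L"
      using that L_subset_cube by (auto simp: unit_cube_def)
    ultimately show "q \<in> K \<longleftrightarrow> q \<in> B 0 \<times> {0..1} \<inter> L"
      using K_iff[of q 0] by (auto simp: mem_Times_iff)
  qed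
  moreover have "emeasure lborel (B 0 \<times> {0..1::real} \<inter> L) = emeasure lborel (B 0 \<times> {0..1::real})"
    using B[of 0] by (intro emeasure_Int_L borel_Times) (auto simp: unit_cube_def)
  moreover have Ks: "K \<in> sets borel" "K \<subseteq> L"
    unfolding K_eq using B[of 0] L_borel by (auto intro!: borel_Times)
  ultimately show "emeasure (Leb_on L) K = 0 \<or> emeasure (Leb_on L) K = 1"
    using B[of 0] by (simp add: emeasure_Leb_on L_borel emeasure_lborel_Times)
  show "K \<in> sets (Leb_on L)" using Ks by (simp add: sets_Leb_on L_borel)
next
  fix E assume E: "E \<in> {space (Leb_on L), {}}"
  have "E \<in> past"
  proof (cases "E = {}")
    case True
    then show ?thesis unfolding past_def by (auto intro!: exI[of _ "{}"])
  next
    case False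
    then show ?thesis using E unfolding past_def by (auto intro!: exI[of _ UNIV])
  qed
  moreover have "E = (g ^^ n) -` E \<inter> L" for n using E L_iterates by auto
  ultimately have "E \<in> pullback_family (Leb_on L) g n past" for n
    unfolding pullback_family_def space_Leb_on by blast
  then show "E \<in> (\<Inter>n. pullback_family (Leb_on L) g n past)" by blast
qed

lemma K_property_baker_g: "K_property (Leb_on L) g"
proof -
  have "has_measurable_inverse (Leb_on L) g"
    unfolding has_measurable_inverse_def
    using S_L_measurable[of 1] L_invariant by (intro bexI[of _ S]) auto
  moreover have "\<exists>E\<in>sets (Leb_on L). emeasure (Leb_on L) (sym_diff C E) = 0"
    if "C \<in> sets (Leb_on L)" for C
    using that by (intro bexI[of _ C]) auto
  then have "eq_mod_null (Leb_on L) (sigma_sets L (\<Union>n. pushforward_family g n past)) (sets (Leb_on L))"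
    unfolding past_generates eq_mod_null_def subset_mod_null_def by blast
  ultimately show ?thesis
    using baker_g_L_measure_preserving past_sub_sigma_algebra past_pushforward past_tail_trivial
    unfolding K_property_def by auto
qed

end

theorem proposition3p2:
  fixes m :: nat and a :: real
  assumes "m \<ge> 2" and "0 < a" and "a \<le> 1 / (2 * real m)"
  shows "exact (Leb_on unit_square) (baker2 m a) \<and>
    K_property (Leb_on (Lambda m a (1 / real m - a))) (baker_g m a)"
proof -
  interpret heterochaos m a by unfold_locales (use assms in auto)
  show ?thesis using exact_baker2 K_property_baker_g by blast
qed

end
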